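(* For each signed graph $\Sigma$ with at least one edge, there exist unique polynomials $\varphi_{\rm even}(\Sigma,x)$ and $\varphi_{\rm odd}(\Sigma,x)$ such that for all integers $n\ge2$, $$\varphi_{\rm odd}(\Sigma,n)=|{\rm F}_{\rm nz}(\Sigma,\mathbb Z_n)|\ \text{ if } n \text{ is odd},\qquad \varphi_{\rm even}(\Sigma,n)=|{\rm F}_{\rm nz}(\Sigma,\mathbb Z_n)|\ \text{ if } n \text{ is even}.$$ Moreover, $\varphi_{\rm odd}(\Sigma,x)$ and $\varphi_{\rm even}(\Sigma,x)$ are specializations of the flow polynomial $\varphi(\Sigma;t,x)$: $$\varphi_{\rm odd}(\Sigma,x)=\varphi(\Sigma;1,x),\qquad\varphi_{\rm even}(\Sigma,x)=\varphi(\Sigma;2,x).$$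
   Context: A graph $(V,E)$ has finite vertex set $V$ and finite edge set $E$ (multiple edges allowed); each edge has two ends, each end is attached to one vertex or to none, and at least one end is attached to a vertex. A loop has both ends at the same vertex, a link has its ends at two distinct vertices, an outer-edge has exactly one end attached to a vertex. A signed graph $\Sigma=(V,E,\sigma)$ is a graph with a sign function $\sigma:E\to\{1,-1\}$. $\mathbb Z_n=\mathbb Z/n\mathbb Z$; ${\rm Tor}_2(\mathbb A)=\{a\in\mathbb A:2a=0\}$. Each edge $e$ has exactly two orientations (arcs) $\vec e$ and $\vec e^{\,-1}$: an orientation puts an arrow on each of the two ends of $e$, with the same direction along $e$ if $e$ is positive and opposite directions if $e$ is negative; $\vec e^{\,-1}$ reverses both arrows. $[v,\vec e\,]$ is $1$ (resp. $-1$) if $\vec e$ is a non-loop arc at $v$ whose arrow at $v$ points to (resp. away from) $v$; $2$ (resp. $-2$) if $\vec e$ is a negative loop at $v$ pointing to (resp. away from) $v$; $0$ otherwise. A flow over an abelian group $\mathbb A$ is a function ${\bf f}$ from arcs to $\mathbb A$ with ${\bf f}(\vec e^{\,-1})=-{\bf f}(\vec e\,)$ and $\sum_{e\in E}[v,\vec e\,]{\bf f}(\vec e\,)=0$ for all $v\in V$. ${\rm F}_{\rm nz}(\Sigma,\mathbb A)$ is the set of flows with ${\bf f}(\vec e\,)\neq0$ for all $e\in E$. The flow polynomial $\varphi(\Sigma;t,x)$ is the unique bivariate polynomial with $|{\rm F}_{\rm nz}(\Sigma,\mathbb A)|=\varphi(\Sigma;|{\rm Tor}_2\mathbb A|,|\mathbb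 A|)$ for every finite abelian group $\mathbb A$; explicitly $\varphi(\Sigma;t,x)=\sum_{S\subseteq E}(-1)^{|E\setminus S|}t^{u_c(S)}x^{|S|-|V|+b(S)}$, where $b(S)$ and $u_c(S)$ are the number of balanced components, resp. of unbalanced components without outer-edges, of $(V,S,\sigma|_S)$. (A signed graph is balanced if it has no outer-edges and every circle, i.e. connected 2-regular subgraph without outer-edges, including loops, has product of edge signs $+1$; otherwise unbalanced.) *)

theory Defs
  imports "HOL-Computational_Algebra.Polynomial" "HOL-Algebra.FiniteProduct" "HOL-Algebra.Elementary_Groups"
begin

text \<open>The two ends of an edge are indexed by \<^typ>\<open>bool\<close>; an unattached end is mapped to \<^term>\<open>None\<close>.\<close>

record ('v, 'e) sgraph =
  verts :: "'v set"
  edges :: "'e set"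
  attach :: "'e \<Rightarrow> bool \<Rightarrow> 'v option"
  esign :: "'e \<Rightarrow> int"

locale signed_graph =
  fixes \<Sigma> :: "('v, 'e) sgraph"
  assumes finite_verts: "finite (verts \<Sigma>)"
    and finite_edges: "finite (edges \<Sigma>)"
    and attach_verts: "e \<in> edges \<Sigma> \<Longrightarrow> attach \<Sigma> e i = Some v \<Longrightarrow> v \<in> verts \<Sigma>"
    and attach_some: "e \<in> edges \<Sigma> \<Longrightarrow> \<exists>i. attach \<Sigma> e i \<noteq> None"
    and esign_pm: "e \<in> edges \<Sigma> \<Longrightarrow> esign \<Sigma> e \<in> {1, -1}"

subsection \<open>Flows\<close>

text \<open>
  An arc is an edge with an arrow on each of its two ends. The arrow on an end is \<^term>\<open>1::int\<close>
  if it points out of the edge (so to the attached vertex, if there is one) and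
  \<^term>\<open>-1::int\<close> if it points into the edge (so away from that vertex). Hence the two arrows
  have the same direction along the edge iff these values are opposite.
\<close>

type_synonym 'e arc = "'e \<times> (bool \<Rightarrow> int)"

definition arcs_of :: "('v, 'e) sgraph \<Rightarrow> 'e \<Rightarrow> 'e arc set" where
  "arcs_of \<Sigma> e = {(e, \<tau>) | \<tau>. (\<forall>i. \<tau> i \<in> {1, -1}) \<and>
     (if esign \<Sigma> e = 1 then \<tau> True = - \<tau> False else \<tau> True = \<tau> False)}"

definition arcs :: "('v, 'e) sgraph \<Rightarrow> 'e arc set" where
  "arcs \<Sigma> = (\<Union>e\<in>edges \<Sigma>. arcs_of \<Sigma> e)"

fun rev_arc :: "'e arc \<Rightarrow> 'e arc" where
  "rev_arc (e, \<tau>) = (e, \<lambda>i. - \<tau> i)"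

fun incidence :: "('v, 'e) sgraph \<Rightarrow> 'v \<Rightarrow> 'e arc \<Rightarrow> int" where
  "incidence \<Sigma> v (e, \<tau>) =
    (if attach \<Sigma> e False = Some v \<and> attach \<Sigma> e True = Some v
       then (if esign \<Sigma> e = -1 then 2 * \<tau> False else 0)
     else if attach \<Sigma> e False = Some v then \<tau> False
     else if attach \<Sigma> e True = Some v then \<tau> True
     else 0)"

text \<open>
  Abelian groups are those of HOL-Algebra, written multiplicatively. Replacing an arc by its
  inverse negates both factors of $[v,e] f(e)$, so the conservation law does not depend on which
  orientation \<open>d\<close> of the edges is used; it is required for all of them. Flows are extensional,
  so that they can be counted.
\<close>

definition flows :: "('v, 'e) sgraph \<Rightarrow> ('a, 'b) monoid_scheme \<Rightarrow> ('e arc \<Rightarrow> 'a) set" where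
  "flows \<Sigma> A = {f \<in> arcs \<Sigma> \<rightarrow>\<^sub>E carrier A.
     (\<forall>a\<in>arcs \<Sigma>. f (rev_arc a) = inv\<^bsub>A\<^esub> (f a)) \<and>
     (\<forall>d. (\<forall>e\<in>edges \<Sigma>. d e \<in> arcs_of \<Sigma> e) \<longrightarrow>
        (\<forall>v\<in>verts \<Sigma>.
           (\<Otimes>\<^bsub>A\<^esub>e\<in>edges \<Sigma>. f (d e) [^]\<^bsub>A\<^esub> incidence \<Sigma> v (d e)) = \<one>\<^bsub>A\<^esub>))}"

definition nz_flows :: "('v, 'e) sgraph \<Rightarrow> ('a, 'b) monoid_scheme \<Rightarrow> ('e arc \<Rightarrow> 'a) set" where
  "nz_flows \<Sigma> A = {f \<in> flows \<Sigma> A. \<forall>a\<in>arcs \<Sigma>. f a \<noteq> \<one>\<^bsub>A\<^esub>}"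

subsection \<open>Balance and components\<close>

definition outer_edge :: "('v, 'e) sgraph \<Rightarrow> 'e \<Rightarrow> bool" where
  "outer_edge \<Sigma> e \<longleftrightarrow> e \<in> edges \<Sigma> \<and> (\<exists>!i. attach \<Sigma> e i \<noteq> None)"

definition adjacency :: "('v, 'e) sgraph \<Rightarrow> ('v \<times> 'v) set" where
  "adjacency \<Sigma> =
     {(u, v). \<exists>e\<in>edges \<Sigma>. \<exists>i. attach \<Sigma> e i = Some u \<and> attach \<Sigma> e (\<not> i) = Some v}"

definition connectivity :: "('v, 'e) sgraph \<Rightarrow> ('v \<times> 'v) set" where
  "connectivity \<Sigma> = (adjacency \<Sigma>)\<^sup>* \<inter> verts \<Sigma> \<times> verts \<Sigma>"

definition vdegree :: "('v, 'e) sgraph \<Rightarrow> 'v \<Rightarrow> nat" where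
  "vdegree \<Sigma> v = card {(e, i). e \<in> edges \<Sigma> \<and> attach \<Sigma> e i = Some v}"

definition is_circle :: "('v, 'e) sgraph \<Rightarrow> bool" where
  "is_circle C \<longleftrightarrow>
     signed_graph C \<and> verts C \<noteq> {} \<and> connectivity C = verts C \<times> verts C \<and>
     (\<forall>v\<in>verts C. vdegree C v = 2) \<and> (\<forall>e. \<not> outer_edge C e)"

definition balanced :: "('v, 'e) sgraph \<Rightarrow> bool" where
  "balanced \<Sigma> \<longleftrightarrow>
     (\<forall>e. \<not> outer_edge \<Sigma> e) \<and>
     (\<forall>W D. W \<subseteq> verts \<Sigma> \<longrightarrow> D \<subseteq> edges \<Sigma> \<longrightarrow> is_circle (\<Sigma>\<lparr>verts := W, edges := D\<rparr>) \<longrightarrow>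
        (\<Prod>e\<in>D. esign \<Sigma> e) = 1)"

text \<open>
  As every edge is attached to some vertex, components correspond to the connectivity classes of
  vertices; outer-edges belong to the component of their only vertex.
\<close>

definition components :: "('v, 'e) sgraph \<Rightarrow> ('v, 'e) sgraph set" where
  "components \<Sigma> =
     (\<lambda>W. \<Sigma>\<lparr>verts := W, edges := {e \<in> edges \<Sigma>. \<exists>i. \<exists>v\<in>W. attach \<Sigma> e i = Some v}\<rparr>) `
       (verts \<Sigma> // connectivity \<Sigma>)"

definition balanced_comps :: "('v, 'e) sgraph \<Rightarrow> nat" where
  "balanced_comps \<Sigma> = card {C \<in> components \<Sigma>. balanced C}"

definition closed_unbalanced_comps :: "('v, 'e) sgraph \<Rightarrow> nat" where
  "closed_unbalanced_comps \<Sigma> =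
     card {C \<in> components \<Sigma>. \<not> balanced C \<and> (\<forall>e. \<not> outer_edge C e)}"

subsection \<open>The flow polynomial\<close>

text \<open>
  A polynomial in \<open>t\<close> whose coefficients are polynomials in \<open>x\<close>, so specializing \<open>t\<close> by
  \<^const>\<open>poly\<close> leaves a polynomial in \<open>x\<close>. The truncated subtraction in the exponent of \<open>x\<close> is
  harmless: a component with $n$ vertices has at least $n-1$ edges if it is balanced and at least
  $n$ edges otherwise.
\<close>

definition flow_poly :: "('v, 'e) sgraph \<Rightarrow> 'k::comm_ring_1 poly poly" where
  "flow_poly \<Sigma> = (\<Sum>S\<in>Pow (edges \<Sigma>).
     (let \<Sigma>S = \<Sigma>\<lparr>edges := S\<rparr> in
      (-1) ^ card (edges \<Sigma> - S) *
      monom (monom 1 (card S + balanced_comps \<Sigma>S - card (verts \<Sigma>)))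
        (closed_unbalanced_comps \<Sigma>S)))"

definition counts_odd_nz_flows :: "('v, 'e) sgraph \<Rightarrow> 'k::comm_ring_1 poly \<Rightarrow> bool" where
  "counts_odd_nz_flows \<Sigma> p \<longleftrightarrow>
     (\<forall>n\<ge>2. odd n \<longrightarrow> poly p (of_nat n) = of_nat (card (nz_flows \<Sigma> (integer_mod_group n))))"

definition counts_even_nz_flows :: "('v, 'e) sgraph \<Rightarrow> 'k::comm_ring_1 poly \<Rightarrow> bool" where
  "counts_even_nz_flows \<Sigma> p \<longleftrightarrow>
     (\<forall>n\<ge>2. even n \<longrightarrow> poly p (of_nat n) = of_nat (card (nz_flows \<Sigma> (integer_mod_group n))))"

end

theory Submission
  imports Defs
begin

text \<open>
  Fix an arc for every edge. A flow over the integers modulo \<open>n\<close> is then a weighting of the edges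
  that lies in the kernel of the incidence matrix, and the flows supported in a set \<open>S\<close> of edges
  are the kernel for the spanning subgraph \<open>(V, S)\<close>. Moebius inversion over \<open>S\<close> therefore
  expresses the number of nowhere-zero flows as an alternating sum of sizes of kernels, and this is
  the alternating sum that defines the flow polynomial, provided that the kernel for a signed
  graph has $t^u n^{|E| - |V| + b}$ elements. Here \<open>b\<close> counts the balanced components, \<open>u\<close> the
  unbalanced components without outer-edges, and \<open>t\<close> is the number of residues \<open>a\<close> with
  \<open>2 a = 0\<close>: it is 1 for odd \<open>n\<close> and 2 for even \<open>n\<close>, which is why the parity of \<open>n\<close> decides which
  specialization of the polynomial counts flows.

  The size of the kernel is found by duality. By orthogonality of the characters of the integers
  modulo \<open>n\<close>, the kernels of a matrix and of its transpose have the same size up to the factor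
  $n^{|E| - |V|}$ (\<open>card_kernel_mod\<close>). The transposed kernel consists of potentials: functions on
  the vertices whose values at the two ends of an edge agree up to the sign of the edge, and which
  vanish at the vertex of an outer-edge. These are easy to count (\<open>card_potentials\<close>), because a
  potential is determined on a component by its value at one vertex. That value is arbitrary
  if the component is balanced; it must be 2-torsion if the component is unbalanced, since
  walking around a negative circle returns the negated value; and it must be 0 if there is an
  outer-edge.

  Balance is defined by the signs of circles, whereas potentials need a switching, that is, a
  function \<open>s\<close> from the vertices to \<open>{1, -1}\<close> such that every edge has the sign \<open>s u * s v\<close>.
  The two notions agree (Harary's theorem, \<open>balanced_iff_switching\<close>). The substantial
  direction produces a negative circle when there is no switching: a minimal set of edges that
  admits no switching is such a circle.

  Each of the two polynomials is determined by its values at infinitely many integers.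
\<close>

section \<open>Kernels of an integer matrix and of its transpose modulo n\<close>

definition mod_character :: "nat \<Rightarrow> int \<Rightarrow> complex" where
  "mod_character n m = cis (2 * pi * of_int m / of_nat n)"

lemma mod_character_add: "mod_character n (a + b) = mod_character n a * mod_character n b"
  by (simp add: mod_character_def cis_mult ring_distribs add_divide_distrib)

lemma mod_character_sum:
  "finite A \<Longrightarrow> mod_character n (\<Sum>i\<in>A. f i) = (\<Prod>i\<in>A. mod_character n (f i))"
  by (induction A rule: finite_induct) (simp_all add: mod_character_add, simp add: mod_character_def)

lemma mod_character_eq_1_iff:
  assumes "n > 0" shows "mod_character n m = 1 \<longleftrightarrow> int n dvd m"
proof
  assume "mod_character n m = 1"
  then obtain k :: int where "2 * pi * of_int m / of_nat n = 2 * pi * of_int k"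
    unfolding mod_character_def
    by (auto simp: complex_eq_iff cos_one_2pi_int mult.commute)
  then have "real_of_int m = of_int (int n * k)"
    using assms by (simp add: field_simps)
  then show "int n dvd m" by (simp only: of_int_eq_iff) simp
next
  assume "int n dvd m"
  then obtain k where "m = int n * k" by (elim dvdE)
  then show "mod_character n m = 1"
    using assms cis_multiple_2pi[of "of_int k"] by (simp add: mod_character_def mult.assoc)
qed

lemma sum_mod_character:
  assumes "n > 0"
  shows "(\<Sum>k\<in>{0..<int n}. mod_character n (q * k)) = (if int n dvd q then of_nat n else 0)"
proof -
  have pow: "mod_character n (q * int k) = mod_character n q ^ k" for k
    by (induction k) (simp_all add: mod_character_add algebra_simps, simp add: mod_character_def)
  have "(\<Sum>k\<in>{0..<int n}. mod_character n (q * k)) = (\<Sum>k<n. mod_character n q ^ k)"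
    by (rule sum.reindex_bij_witness[of _ int nat]) (auto simp: pow[symmetric])
  also have "\<dots> = (if int n dvd q then of_nat n else 0)"
  proof (cases "mod_character n q = 1")
    case False
    have "mod_character n q ^ n = 1"
      using mod_character_eq_1_iff[OF assms, of "q * int n"] by (simp add: pow[symmetric])
    with False show ?thesis
      using geometric_sum[OF False, of n] mod_character_eq_1_iff[OF assms, of q] by simp
  qed (use mod_character_eq_1_iff[OF assms, of q] in simp)
  finally show ?thesis .
qed

text \<open>
  Both sides are evaluations of the sum of the characters of \<open>\<Sum>v e. M v e * g e * p v\<close> over all
  pairs \<open>(g, p)\<close>: summing over \<open>p\<close> first leaves the kernel of \<open>M\<close>, summing over \<open>g\<close> first leaves
  the kernel of the transpose.
\<close>

lemma card_kernel_mod: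
  fixes M :: "'v \<Rightarrow> 'e \<Rightarrow> int"
  assumes n: "n > 0" and V: "finite V" and E: "finite E"
  shows "card {g \<in> E \<rightarrow>\<^sub>E {0..<int n}. \<forall>v\<in>V. int n dvd (\<Sum>e\<in>E. M v e * g e)} * n ^ card V
       = card {p \<in> V \<rightarrow>\<^sub>E {0..<int n}. \<forall>e\<in>E. int n dvd (\<Sum>v\<in>V. M v e * p v)} * n ^ card E"
proof -
  have *: "(\<Sum>p\<in>A \<rightarrow>\<^sub>E {0..<int n}. mod_character n (\<Sum>a\<in>A. q a * p a))
      = (if \<forall>a\<in>A. int n dvd q a then of_nat (n ^ card A) else 0)"
    if A: "finite A" for A :: "'x set" and q
  proof -
    have "(\<Sum>p\<in>A \<rightarrow>\<^sub>E {0..<int n}. mod_character n (\<Sum>a\<in>A. q a * p a))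
        = (\<Prod>a\<in>A. \<Sum>k\<in>{0..<int n}. mod_character n (q a * k))"
      using A by (simp add: mod_character_sum prod_sum_PiE)
    also have "\<dots> = (\<Prod>a\<in>A. if int n dvd q a then of_nat n else 0)"
      by (simp add: sum_mod_character[OF n])
    also have "\<dots> = (if \<forall>a\<in>A. int n dvd q a then of_nat (n ^ card A) else 0)"
      using A by (auto intro!: prod.cong)
    finally show ?thesis .
  qed
  let ?F = "E \<rightarrow>\<^sub>E {0..<int n}" and ?P = "V \<rightarrow>\<^sub>E {0..<int n}"
  have fin: "finite ?F" "finite ?P" using V E by (auto intro: finite_PiE)
  have "complex_of_nat (card {g \<in> ?F. \<forall>v\<in>V. int n dvd (\<Sum>e\<in>E. M v e * g e)} * n ^ card V)
      = (\<Sum>g\<in>?F. if \<forall>v\<in>V. int n dvd (\<Sum>e\<in>E. M v e * g e) then of_nat (n ^ card V) else 0)"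
    using fin by (simp add: sum.If_cases Int_def)
  also have "\<dots> = (\<Sum>g\<in>?F. \<Sum>p\<in>?P. mod_character n (\<Sum>v\<in>V. (\<Sum>e\<in>E. M v e * g e) * p v))"
    by (simp only: *[OF V])
  also have "\<dots> = (\<Sum>p\<in>?P. \<Sum>g\<in>?F. mod_character n (\<Sum>e\<in>E. (\<Sum>v\<in>V. M v e * p v) * g e))"
  proof -
    have "(\<Sum>v\<in>V. (\<Sum>e\<in>E. M v e * g e) * p v) = (\<Sum>e\<in>E. (\<Sum>v\<in>V. M v e * p v) * g e)"
      for g p unfolding sum_distrib_right by (subst sum.swap) (simp add: mult_ac)
    then show ?thesis by (simp only: sum.swap[of _ ?F ?P])
  qed
  also have "\<dots> = (\<Sum>p\<in>?P. if \<forall>e\<in>E. int n dvd (\<Sum>v\<in>V. M v e * p v) then of_nat (n ^ card E) else 0)"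
    by (simp only: *[OF E])
  also have "\<dots> = complex_of_nat (card {p \<in> ?P. \<forall>e\<in>E. int n dvd (\<Sum>v\<in>V. M v e * p v)} * n ^ card E)"
    using fin by (simp add: sum.If_cases Int_def)
  finally show ?thesis by (simp only: of_nat_eq_iff)
qed

section \<open>Connectivity classes and components\<close>

lemma sym_adjacency: "sym (adjacency G)"
proof (rule symI)
  fix u v assume "(u, v) \<in> adjacency G"
  then obtain e i where "e \<in> edges G" "attach G e i = Some u" "attach G e (\<not> i) = Some v"
    by (auto simp: adjacency_def)
  then show "(v, u) \<in> adjacency G"
    unfolding adjacency_def by (auto intro!: bexI[of _ e] exI[of _ "\<not> i"])
qed

lemma equiv_connectivity: "equiv (verts G) (connectivity G)"
proof (rule equivI)
  show "sym (connectivity G)"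
    using sym_rtrancl[OF sym_adjacency[of G]] unfolding connectivity_def sym_def by blast
  show "trans (connectivity G)"
    unfolding connectivity_def by (auto intro!: transI intro: rtrancl_trans)
qed (auto simp: connectivity_def refl_on_def)

lemma connectivity_step:
  assumes "signed_graph G" "e \<in> edges G" "attach G e i = Some u" "attach G e (\<not> i) = Some v"
  shows "(u, v) \<in> connectivity G"
  using assms signed_graph.attach_verts[OF assms(1,2)]
  by (auto simp: connectivity_def adjacency_def intro!: r_into_rtrancl)

lemma class_connected:
  assumes "W \<in> verts G // connectivity G" "u \<in> W" "v \<in> W"
  shows "(u, v) \<in> connectivity G"
  using assms quotient_eq_iff[OF equiv_connectivity] by metis

lemma class_subset: "W \<in> verts G // connectivity G \<Longrightarrow> W \<subseteq> verts G"
  by (auto simp: quotient_def connectivity_def)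

lemma class_closed:
  assumes "signed_graph G" "W \<in> verts G // connectivity G" "e \<in> edges G"
    "attach G e i = Some u" "u \<in> W" "attach G e j = Some v"
  shows "v \<in> W"
proof (cases "i = j")
  case False
  then have "j = (\<not> i)" by auto
  then have "(u, v) \<in> connectivity G" using assms by (intro connectivity_step[of G e i]) auto
  then show ?thesis using assms(2,5) equiv_connectivity[of G]
    by (meson in_quotient_imp_closed)
qed (use assms in auto)

definition component_of :: "('v, 'e) sgraph \<Rightarrow> 'v set \<Rightarrow> ('v, 'e) sgraph" where
  "component_of G W =
     G\<lparr>verts := W, edges := {e \<in> edges G. \<exists>i. \<exists>v\<in>W. attach G e i = Some v}\<rparr>"

lemma component_of_simps [simp]:
  "verts (component_of G W) = W"
  "edges (component_of G W) = {e \<in> edges G. \<exists>i. \<exists>v\<in>W. attach G e i = Some v}"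
  "attach (component_of G W) = attach G" "esign (component_of G W) = esign G"
  by (simp_all add: component_of_def)

lemma components_eq: "components G = component_of G ` (verts G // connectivity G)"
  by (simp add: components_def component_of_def[abs_def])

lemma inj_component_of: "inj_on (component_of G) A"
  by (rule inj_onI) (metis component_of_simps(1))

lemma signed_graph_component:
  assumes "signed_graph G" "W \<in> verts G // connectivity G"
  shows "signed_graph (component_of G W)"
proof
  show "finite (verts (component_of G W))"
    using finite_subset[OF class_subset[OF assms(2)] signed_graph.finite_verts[OF assms(1)]] by simp
  show "finite (edges (component_of G W))"
    using signed_graph.finite_edges[OF assms(1)] by simp
  fix e assume e: "e \<in> edges (component_of G W)"
  then have eG: "e \<in> edges G" by simp
  show "\<exists>i. attach (component_of G W) e i \<noteq> None"
    using signed_graph.attach_some[OF assms(1) eG] by simp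
  show "esign (component_of G W) e \<in> {1, -1}"
    using signed_graph.esign_pm[OF assms(1) eG] by simp
  fix j v assume j: "attach (component_of G W) e j = Some v"
  obtain i u where "attach G e i = Some u" "u \<in> W" using e by auto
  then show "v \<in> verts (component_of G W)"
    using class_closed[OF assms eG, of i u j v] j by simp
qed

section \<open>Balance as the existence of a switching\<close>

text \<open>
  Total version of \<^const>\<open>attach\<close> for graphs in which both ends of every edge are attached.
\<close>

definition end_of :: "('v, 'e) sgraph \<Rightarrow> 'e \<Rightarrow> bool \<Rightarrow> 'v" where
  "end_of G e i = the (attach G e i)"

text \<open>
  The sign pattern on \<open>D\<close> becomes all-positive after switching at the vertices with \<open>s v = -1\<close>.
  The edge set is a parameter so that subsets of the edges can be treated without changing the
  graph.
\<close>

definition switches :: "('v, 'e) sgraph \<Rightarrow> 'e set \<Rightarrow> ('v \<Rightarrow> int) \<Rightarrow> bool" where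
  "switches G D s \<longleftrightarrow> (\<forall>v. s v \<in> {1, -1}) \<and>
     (\<forall>e\<in>D. s (end_of G e False) * s (end_of G e True) = esign G e)"

lemma attach_end_of:
  assumes "signed_graph G" "\<forall>e. \<not> outer_edge G e" "e \<in> edges G"
  shows "attach G e i = Some (end_of G e i)"
proof -
  obtain j where j: "attach G e j \<noteq> None"
    using signed_graph.attach_some[OF assms(1,3)] by blast
  have "attach G e (\<not> j) \<noteq> None"
  proof
    assume "attach G e (\<not> j) = None"
    then have "i = j" if "attach G e i \<noteq> None" for i using that by (cases "i = j") auto
    then show False using assms(2,3) j unfolding outer_edge_def by blast
  qed
  with j have "attach G e i \<noteq> None" by (cases "i = j") auto
  then show ?thesis by (auto simp: end_of_def)
qed

text \<open>
  Double counting of incidences, in multiplicative form. Taking the constant 2 for \<open>h\<close> gives the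
  handshake lemma; taking a switching for \<open>h\<close> gives the product of the edge signs.
\<close>

lemma prod_over_ends:
  fixes h :: "'v \<Rightarrow> 'r::comm_monoid_mult"
  assumes "signed_graph C" "\<forall>e. \<not> outer_edge C e"
  shows "(\<Prod>e\<in>edges C. h (end_of C e False) * h (end_of C e True))
       = (\<Prod>v\<in>verts C. h v ^ vdegree C v)"
proof -
  have fin: "finite (edges C \<times> (UNIV :: bool set))" "finite (verts C)"
    using assms(1) by (auto simp: signed_graph_def)
  have "(\<Prod>e\<in>edges C. h (end_of C e False) * h (end_of C e True))
      = (\<Prod>(e, i)\<in>edges C \<times> UNIV. h (end_of C e i))"
    by (simp add: prod.cartesian_product[symmetric] UNIV_bool)
  also have "\<dots> = (\<Prod>v\<in>verts C. \<Prod>(e, i)\<in>{x \<in> edges C \<times> UNIV. (case x of (e, i) \<Rightarrow> end_of C e i) = v}.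
      h (end_of C e i))"
    by (rule prod.group[symmetric, OF fin])
       (auto simp: attach_end_of[OF assms] intro: signed_graph.attach_verts[OF assms(1)])
  also have "\<dots> = (\<Prod>v\<in>verts C. h v ^ vdegree C v)"
  proof (rule prod.cong[OF refl])
    fix v
    have I: "{x \<in> edges C \<times> UNIV. (case x of (e, i) \<Rightarrow> end_of C e i) = v}
        = {(e, i). e \<in> edges C \<and> attach C e i = Some v}"
      by (auto simp: attach_end_of[OF assms])
    have "(\<Prod>(e, i)\<in>{(e, i). e \<in> edges C \<and> attach C e i = Some v}. h (end_of C e i))
        = (\<Prod>x\<in>{(e, i). e \<in> edges C \<and> attach C e i = Some v}. h v)"
      by (rule prod.cong) (auto simp: end_of_def)
    then show "(\<Prod>(e, i)\<in>{x \<in> edges C \<times> UNIV. (case x of (e, i) \<Rightarrow> end_of C e i) = v}.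
      h (end_of C e i)) = h v ^ vdegree C v"
      by (simp only: I prod_constant vdegree_def)
  qed
  finally show ?thesis .
qed

lemma handshake:
  assumes "signed_graph C" "\<forall>e. \<not> outer_edge C e"
  shows "(\<Sum>v\<in>verts C. vdegree C v) = 2 * card (edges C)"
proof -
  have "(2::nat) ^ (\<Sum>v\<in>verts C. vdegree C v) = 2 ^ (2 * card (edges C))"
    using prod_over_ends[OF assms, of "\<lambda>_. 2 :: nat"]
    by (simp add: power_sum power_mult)
  then show ?thesis by simp
qed

text \<open>
  In the product of \<open>s u * s v\<close> over the edges, every vertex of a circle contributes its value
  twice.
\<close>

lemma circle_prod_eq_1:
  assumes C: "is_circle C" and s: "switches C (edges C) s"
  shows "(\<Prod>e\<in>edges C. esign C e) = 1"
proof -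
  have "(\<Prod>e\<in>edges C. esign C e) = (\<Prod>e\<in>edges C. s (end_of C e False) * s (end_of C e True))"
    using s by (simp add: switches_def)
  also have "\<dots> = (\<Prod>v\<in>verts C. s v ^ 2)"
    using C by (simp add: prod_over_ends is_circle_def)
  also have "\<dots> = (\<Prod>v\<in>verts C. 1)"
  proof (rule prod.cong[OF refl])
    fix v
    have "s v = 1 \<or> s v = -1" using s by (auto simp: switches_def)
    then show "s v ^ 2 = 1" by auto
  qed
  finally show ?thesis by simp
qed

text \<open>
  Take a minimal set \<open>D\<close> of edges without a switching and let \<open>W\<close> be the set of its ends. For
  every \<open>e \<in> D\<close>, minimality gives a function \<open>s e\<close> which is right on all edges of \<open>D\<close> except on \<open>e\<close>.
  
  No vertex has degree 1, since changing \<open>s e\<close> at a vertex of degree 1 with edge \<open>e\<close> would repair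
  \<open>e\<close>. Multiplying the functions \<open>s e\<close> for \<open>e\<close> in a subset \<open>Y\<close> of \<open>D\<close> gives distinct functions for
  distinct \<open>Y\<close>, so \<open>D\<close> has at most as many elements as \<open>W\<close>; by the handshake lemma all degrees are
  then equal to 2. If \<open>D\<close> were disconnected, switchings of two proper parts could be glued. So \<open>D\<close> is a
  circle, and \<open>s e\<close>, which is wrong on exactly one edge, shows that its sign is negative.
\<close>

lemma switching_exists_if_no_negative_circle:
  assumes G: "signed_graph G" and closed: "\<forall>e. \<not> outer_edge G e"
    and circles: "\<And>W D. W \<subseteq> verts G \<Longrightarrow> D \<subseteq> edges G \<Longrightarrow> is_circle (G\<lparr>verts := W, edges := D\<rparr>) \<Longrightarrow>
      (\<Prod>e\<in>D. esign G e) = 1"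
  shows "\<exists>s. switches G (edges G) s"
proof (rule ccontr)
  assume "\<nexists>s. switches G (edges G) s"
  define X where "X = {D. D \<subseteq> edges G \<and> (\<nexists>s. switches G D s)}"
  have finE: "finite (edges G)" using G by (simp add: signed_graph_def)
  then have "finite X" by (simp add: X_def)
  moreover have "edges G \<in> X" using \<open>\<nexists>s. switches G (edges G) s\<close> by (simp add: X_def)
  ultimately obtain D where DX: "D \<in> X" and min_X: "\<And>D'. D' \<in> X \<Longrightarrow> D' \<subseteq> D \<Longrightarrow> D = D'"
    using finite_has_minimal[of X] by (metis empty_iff)
  have D: "D \<subseteq> edges G" "\<not> switches G D s" for s
    using DX by (auto simp: X_def)
  have min: "\<exists>s. switches G D' s" if "D' \<subset> D" for D'
  proof (rule ccontr)
    assume "\<nexists>s. switches G D' s"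
    then have "D' \<in> X" using that D(1) by (simp add: X_def)
    then show False using min_X[of D'] that by blast
  qed
  have finD: "finite D" using D(1) finE by (rule finite_subset)
  define W where "W = (\<Union>e\<in>D. range (end_of G e))"
  define C where "C = G\<lparr>verts := W, edges := D\<rparr>"
  have att: "attach G e i = Some (end_of G e i)" if "e \<in> D" for e i
    using attach_end_of[OF G closed] D(1) that by blast
  have C_simps: "verts C = W" "edges C = D" "attach C = attach G" "esign C = esign G"
    by (simp_all add: C_def)
  have end_C: "end_of C = end_of G" by (simp add: end_of_def fun_eq_iff C_simps)
  have finW: "finite W" using finD by (simp add: W_def)
  have endW: "end_of G e i \<in> W" if "e \<in> D" for e i using that by (auto simp: W_def)
  have sgC: "signed_graph C"
    using finD finW D(1) signed_graph.esign_pm[OF G] att endW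
    by (auto simp: signed_graph_def C_simps)
  have closedC: "\<forall>e. \<not> outer_edge C e"
    using att by (auto simp: outer_edge_def C_simps)
  have "D \<noteq> {}" using D(2)[of "\<lambda>_. 1"] by (auto simp: switches_def)
  then obtain r where r: "r \<in> W" by (auto simp: W_def)

  have edge_cases: "s x * s y = esign G e \<or> s x * s y = - esign G e"
    if "e \<in> D" "\<And>v. s v \<in> {1, -1::int}" for e s x y
  proof -
    have "esign G e \<in> {1, -1}" using signed_graph.esign_pm[OF G] D(1) that(1) by blast
    then show ?thesis using that(2)[of x] that(2)[of y] by auto
  qed

  \<comment> \<open>The value at \<open>r\<close> can be prescribed, since \<open>s\<close> and \<open>- s\<close> are wrong on the same edges. With
    the value -1, a product of such functions reveals the parity of the number of factors.\<close>
  have "\<exists>s. (\<forall>v. s v \<in> {1, -1}) \<and> s r = -1 \<and>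
      (\<forall>f\<in>D. s (end_of G f False) * s (end_of G f True) = (if f = e then -1 else 1) * esign G f)"
    if e: "e \<in> D" for e
  proof -
    obtain s where s: "switches G (D - {e}) s" using min[of "D - {e}"] e by blast
    then have pm: "\<And>v. s v \<in> {1, -1}" by (simp add: switches_def)
    have "s (end_of G e False) * s (end_of G e True) \<noteq> esign G e"
      using D(2)[of s] s by (auto simp: switches_def)
    then have "s (end_of G e False) * s (end_of G e True) = - esign G e"
      using edge_cases[OF e, of s] pm by blast
    then have edge: "\<forall>f\<in>D. s (end_of G f False) * s (end_of G f True) = (if f = e then -1 else 1) * esign G f"
      using s by (auto simp: switches_def)
    show ?thesis
    proof (cases "s r = 1")
      case True
      have "- s v \<in> {1, -1}" for v using pm[of v] by auto
      then show ?thesis using edge True by (intro exI[of _ "\<lambda>v. - s v"]) simp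
    next
      case False
      then have "s r = -1" using pm[of r] by simp
      then show ?thesis using edge pm by (intro exI[of _ s]) simp
    qed
  qed
  then obtain s where s_pm: "\<And>e v. e \<in> D \<Longrightarrow> s e v \<in> {1, -1::int}" and s_r: "\<And>e. e \<in> D \<Longrightarrow> s e r = -1"
    and s_edge: "\<And>e f. e \<in> D \<Longrightarrow> f \<in> D \<Longrightarrow>
      s e (end_of G f False) * s e (end_of G f True) = (if f = e then -1 else 1) * esign G f"
    by metis

  have "card (Pow D) \<le> card (W \<rightarrow>\<^sub>E {1, -1::int})"
  proof (rule card_inj_on_le)
    let ?h = "\<lambda>Y. \<lambda>v\<in>W. \<Prod>e\<in>Y. s e v"
    have prod_pm: "(\<Prod>e\<in>Y. s e v) \<in> {1, -1}" if "Y \<subseteq> D" for Y v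
      using finite_subset[OF that finD] that
    proof (induction Y rule: finite_induct)
      case (insert e Y)
      then show ?case using s_pm[of e v] by auto
    qed simp
    show "?h ` Pow D \<subseteq> W \<rightarrow>\<^sub>E {1, -1}"
    proof (intro image_subsetI PiE_I)
      fix Y v assume "Y \<in> Pow D" "v \<in> W"
      then show "?h Y v \<in> {1, -1}" using prod_pm[of Y v] by simp
    qed simp
    \<comment> \<open>The set \<open>Y\<close> can be read off from the product function edge by edge, once the parity of
      \<open>card Y\<close> is known; the value at \<open>r\<close> provides this parity.\<close>
    have edge: "?h Y (end_of G f False) * ?h Y (end_of G f True)
        = (if f \<in> Y then -1 else 1) * esign G f ^ card Y" if "Y \<subseteq> D" "f \<in> D" for Y f
    proof -
      have "?h Y (end_of G f False) * ?h Y (end_of G f True)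
          = (\<Prod>e\<in>Y. s e (end_of G f False) * s e (end_of G f True))"
        using that endW by (simp add: prod.distrib)
      also have "\<dots> = (\<Prod>e\<in>Y. (if f = e then -1 else 1) * esign G f)"
        using that s_edge by (intro prod.cong) auto
      also have "\<dots> = (if f \<in> Y then -1 else 1) * esign G f ^ card Y"
        using finite_subset[OF that(1) finD] by (simp add: prod.distrib)
      finally show ?thesis .
    qed
    have root: "?h Y r = (-1) ^ card Y" if "Y \<subseteq> D" for Y
      using that r s_r by (simp add: subset_iff)
    show "inj_on ?h (Pow D)"
    proof (rule inj_onI)
      fix Y Z assume YZ: "Y \<in> Pow D" "Z \<in> Pow D" "?h Y = ?h Z"
      then have "(-1::int) ^ card Y = (-1) ^ card Z" using root[of Y] root[of Z] by simp
      then have parity: "even (card Y) \<longleftrightarrow> even (card Z)"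
        by (metis neg_one_even_power neg_one_odd_power one_neq_neg_one)
      have "f \<in> Y \<longleftrightarrow> f \<in> Z" if f: "f \<in> D" for f
      proof -
        have "esign G f \<in> {1, -1}" using signed_graph.esign_pm[OF G] D(1) f by blast
        then have "esign G f ^ card Y = esign G f ^ card Z" "esign G f ^ card Z \<noteq> 0"
          using parity by (auto simp: minus_one_power_iff)
        with edge[of Y f] edge[of Z f] YZ f show ?thesis by (auto split: if_splits)
      qed
      with YZ show "Y = Z" by blast
    qed
  qed (simp add: finW finite_PiE)
  then have "(2::nat) ^ card D \<le> 2 ^ card W"
    using finD finW by (simp add: card_Pow card_funcsetE numeral_2_eq_2)
  then have card_le: "card D \<le> card W"
    by (rule power_le_imp_le_exp[rotated]) simp

  have deg_ge: "vdegree C v \<ge> 2" if v: "v \<in> W" for v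
  proof (rule ccontr)
    let ?I = "{(e, i). e \<in> D \<and> attach G e i = Some v}"
    have finI: "finite ?I" by (rule finite_subset[of _ "D \<times> UNIV"]) (auto simp: finD)
    assume "\<not> vdegree C v \<ge> 2"
    then have "card ?I \<le> Suc 0" by (simp add: vdegree_def C_simps)
    then have at_most_one: "\<forall>x\<in>?I. \<forall>y\<in>?I. x = y"
      by (simp only: card_le_Suc0_iff_eq[OF finI])
    obtain e i where ei: "e \<in> D" "end_of G e i = v" using v by (auto simp: W_def)
    have uniq: "f = e \<and> j = i" if "f \<in> D" "end_of G f j = v" for f j
      using bspec[OF bspec[OF at_most_one, of "(f, j)"], of "(e, i)"] that ei att by simp
    have other: "end_of G e (\<not> i) \<noteq> v" using uniq[OF ei(1), of "\<not> i"] by auto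
    let ?s = "(s e)(v := - s e v)"
    have "switches G D ?s" unfolding switches_def
    proof (intro conjI allI ballI)
      show "?s x \<in> {1, -1}" for x using s_pm[OF ei(1), of x] s_pm[OF ei(1), of v] by auto
      fix f assume f: "f \<in> D"
      show "?s (end_of G f False) * ?s (end_of G f True) = esign G f"
      proof (cases "f = e")
        case True
        then show ?thesis using s_edge[OF ei(1) ei(1)] ei(2) other by (cases i) auto
      next
        case False
        then have "end_of G f j \<noteq> v" for j using uniq[OF f] by blast
        then show ?thesis using s_edge[OF ei(1) f] False by simp
      qed
    qed
    with D(2) show False by blast
  qed
  have deg: "vdegree C v = 2" if v: "v \<in> W" for v
  proof -
    \<comment> \<open>The degrees are at least 2, and their average is at most 2.\<close>
    have sum_le: "(\<Sum>v\<in>W. vdegree C v) \<le> (\<Sum>v\<in>W. 2)"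
      using handshake[OF sgC closedC] card_le by (simp add: C_simps)
    show ?thesis
    proof (rule ccontr)
      assume "vdegree C v \<noteq> 2"
      then have "(\<Sum>v\<in>W. 2) < (\<Sum>v\<in>W. vdegree C v)"
        using deg_ge v finW by (intro sum_strict_mono_ex1) (auto intro!: bexI[of _ v] simp: le_neq_implies_less)
      with sum_le show False by simp
    qed
  qed

  \<comment> \<open>A class \<open>U\<close> different from \<open>W\<close> would split \<open>D\<close> into two proper subsets, whose
    switchings combine to one of \<open>D\<close>.\<close>
  have "connectivity C = W \<times> W"
  proof -
    define U where "U = connectivity C `` {r}"
    have equiv: "equiv W (connectivity C)" using equiv_connectivity[of C] by (simp add: C_simps)
    have same: "end_of G e i \<in> U \<longleftrightarrow> end_of G e j \<in> U" if "e \<in> D" for e i j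
    proof -
      have "(end_of G e i, end_of G e j) \<in> connectivity C"
      proof (cases "i = j")
        case True
        then show ?thesis using endW[OF that] equiv by (simp add: equiv_def refl_on_def)
      next
        case False
        then have "j = (\<not> i)" by auto
        then show ?thesis using att[OF that] that by (intro connectivity_step[OF sgC, of e]) (auto simp: C_simps)
      qed
      then show ?thesis unfolding U_def using equiv by (meson Image_singleton_iff equivE symE transE)
    qed
    have "W \<subseteq> U"
    proof (rule ccontr)
      assume "\<not> W \<subseteq> U"
      then obtain w where w: "w \<in> W" "w \<notin> U" by blast
      have rU: "r \<in> U" using r equiv by (simp add: U_def equiv_def refl_on_def)
      let ?D1 = "{e \<in> D. end_of G e False \<in> U}" and ?D2 = "{e \<in> D. end_of G e False \<notin> U}"
      obtain e i where "e \<in> D" "end_of G e i = r" using r by (auto simp: W_def)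
      then have "?D2 \<subset> D" using rU same by blast
      moreover obtain f j where "f \<in> D" "end_of G f j = w" using w by (auto simp: W_def)
      then have "?D1 \<subset> D" using w same by blast
      ultimately obtain s1 s2 where s12: "switches G ?D1 s1" "switches G ?D2 s2" using min by meson
      have "switches G D (\<lambda>v. if v \<in> U then s1 v else s2 v)"
        using s12 same by (auto simp: switches_def)
      with D(2) show False by blast
    qed
    then have "(u, v) \<in> connectivity C" if "u \<in> W" "v \<in> W" for u v
      using that equiv unfolding U_def by (meson Image_singleton_iff equivE subsetD symE transE)
    then show ?thesis using equiv by (auto simp: connectivity_def C_simps)
  qed
  then have "is_circle C"
    using sgC closedC deg r by (auto simp: is_circle_def C_simps)
  moreover have "W \<subseteq> verts G"
    using att D(1) signed_graph.attach_verts[OF G] by (auto simp: W_def)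
  ultimately have prod: "(\<Prod>e\<in>D. esign G e) = 1" using circles D(1) by (simp add: C_def)

  obtain e where e: "e \<in> D" using \<open>D \<noteq> {}\<close> by blast
  have "(\<Prod>f\<in>D. s e (end_of G f False) * s e (end_of G f True)) = (\<Prod>v\<in>W. s e v ^ 2)"
    using prod_over_ends[OF sgC closedC, of "s e"] deg by (simp add: C_simps end_C)
  also have "\<dots> = (\<Prod>v\<in>W. 1)"
  proof (rule prod.cong[OF refl])
    show "s e v ^ 2 = 1" for v using s_pm[OF e, of v] by auto
  qed
  finally have "(\<Prod>f\<in>D. (if f = e then -1 else 1) * esign G f) = 1"
    using s_edge[OF e] by simp
  then show False
    using prod e finD by (simp add: prod.distrib)
qed

text \<open>
  Harary's balance theorem, for graphs that need not be connected.
\<close>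

lemma balanced_iff_switching:
  assumes G: "signed_graph G"
  shows "balanced G \<longleftrightarrow> (\<forall>e. \<not> outer_edge G e) \<and> (\<exists>s. switches G (edges G) s)"
proof
  assume "balanced G"
  then show "(\<forall>e. \<not> outer_edge G e) \<and> (\<exists>s. switches G (edges G) s)"
    using switching_exists_if_no_negative_circle[OF G] by (simp add: balanced_def)
next
  assume R: "(\<forall>e. \<not> outer_edge G e) \<and> (\<exists>s. switches G (edges G) s)"
  then obtain s where s: "switches G (edges G) s" by blast
  have "(\<Prod>e\<in>D. esign G e) = 1"
    if "D \<subseteq> edges G" "is_circle (G\<lparr>verts := W, edges := D\<rparr>)" for W D
  proof -
    have "switches (G\<lparr>verts := W, edges := D\<rparr>) D s"
      using s that(1) by (auto simp: switches_def end_of_def)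
    then show ?thesis using circle_prod_eq_1[OF that(2), of s] by simp
  qed
  with R show "balanced G" by (simp add: balanced_def)
qed

section \<open>Potentials: the kernel of the transposed incidence matrix\<close>

text \<open>
  The edge \<open>e\<close> forces its two ends to agree up to its sign, or forces the value at its only vertex
  to vanish. A negative loop forces \<open>2 * p u\<close> to vanish. The condition is stated from both ends,
  which is harmless because signs are their own inverses.
\<close>

definition potential_at :: "('v, 'e) sgraph \<Rightarrow> nat \<Rightarrow> ('v \<Rightarrow> int) \<Rightarrow> 'e \<Rightarrow> bool" where
  "potential_at G n p e \<longleftrightarrow> (\<forall>i u. attach G e i = Some u \<longrightarrow>
     int n dvd (case attach G e (\<not> i) of None \<Rightarrow> p u | Some v \<Rightarrow> p u - esign G e * p v))"

definition potential :: "('v, 'e) sgraph \<Rightarrow> nat \<Rightarrow> ('v \<Rightarrow> int) \<Rightarrow> bool" where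
  "potential G n p \<longleftrightarrow> (\<forall>e\<in>edges G. potential_at G n p e)"

text \<open>
  Potentials are the kernel of the transposed incidence matrix, whatever arc is chosen for each
  edge.
\<close>

lemma dvd_sum_incidence_iff_potential_at:
  assumes G: "signed_graph G" and e: "e \<in> edges G" and d: "d \<in> arcs_of G e"
  shows "int n dvd (\<Sum>v\<in>verts G. incidence G v d * p v) \<longleftrightarrow> potential_at G n p e"
proof -
  obtain \<tau> where d_eq: "d = (e, \<tau>)" and pm: "\<And>i. \<tau> i = 1 \<or> \<tau> i = -1"
    and dir: "if esign G e = 1 then \<tau> True = - \<tau> False else \<tau> True = \<tau> False"
    using d by (auto simp: arcs_of_def)
  have \<sigma>: "esign G e = 1 \<or> esign G e = -1" using signed_graph.esign_pm[OF G e] by simp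
  have fin: "finite (verts G)" using G by (simp add: signed_graph_def)
  have inV: "u \<in> verts G" if "attach G e i = Some u" for i u
    using signed_graph.attach_verts[OF G e that] .
  have sum1: "(\<Sum>v\<in>verts G. (if v = u then c else 0) * p v) = c * p u" if "u \<in> verts G" for u c
    using fin that by (simp add: if_distrib[where f="\<lambda>x. x * _"] sum.delta cong: if_cong)
  have scale: "int n dvd \<tau> i * x \<longleftrightarrow> int n dvd x" for i x using pm[of i] by auto
  have pot: "potential_at G n p e \<longleftrightarrow>
     (\<forall>u. attach G e False = Some u \<longrightarrow>
       int n dvd (case attach G e True of None \<Rightarrow> p u | Some v \<Rightarrow> p u - esign G e * p v)) \<and>
     (\<forall>u. attach G e True = Some u \<longrightarrow>
       int n dvd (case attach G e False of None \<Rightarrow> p u | Some v \<Rightarrow> p u - esign G e * p v))"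
    by (auto simp: potential_at_def all_bool_eq)
  show ?thesis
  proof (cases "attach G e False")
    case None
    obtain i u where "attach G e i = Some u" using signed_graph.attach_some[OF G e] by blast
    then have u: "attach G e True = Some u" using None by (cases i) auto
    have "incidence G v d = (if v = u then \<tau> True else 0)" for v
      using None u by (auto simp: d_eq)
    then show ?thesis
      using None u inV[OF u] by (simp add: sum1 scale pot)
  next
    case (Some u)
    show ?thesis
    proof (cases "attach G e True")
      case None
      have "incidence G v d = (if v = u then \<tau> False else 0)" for v
        using None Some by (auto simp: d_eq)
      then show ?thesis
        using None Some inV[OF Some] by (simp add: sum1 scale pot)
    next
      case w: (Some w)
      show ?thesis
      proof (cases "u = w")
        case True
        have "incidence G v d = (if v = u then (if esign G e = -1 then 2 * \<tau> False else 0) else 0)" for v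
          using w Some True by (auto simp: d_eq)
        then have "(\<Sum>v\<in>verts G. incidence G v d * p v)
            = (if esign G e = -1 then 2 * \<tau> False else 0) * p u"
          using inV[OF Some] by (simp only: sum1)
        then show ?thesis
          using w Some True \<sigma> scale[of False "2 * p u"] by (auto simp: pot mult_ac)
      next
        case False
        have "incidence G v d = (if v = u then \<tau> False else 0) + (if v = w then \<tau> True else 0)" for v
          using w Some False by (auto simp: d_eq)
        then have "(\<Sum>v\<in>verts G. incidence G v d * p v) = \<tau> False * p u + \<tau> True * p w"
          using inV[OF Some] inV[OF w] by (simp only: ring_distribs sum.distrib sum1)
        also have "\<dots> = \<tau> False * (p u - esign G e * p w)"
          using dir \<sigma> by (auto simp: algebra_simps)
        finally have *: "int n dvd (\<Sum>v\<in>verts G. incidence G v d * p v)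
            \<longleftrightarrow> int n dvd p u - esign G e * p w" by (simp only: scale)
        have "int n dvd p w - esign G e * p u \<longleftrightarrow> int n dvd p u - esign G e * p w"
          using \<sigma> dvd_minus_iff[of "int n" "p u - p w"] by (auto simp: add.commute)
        then show ?thesis using w Some * by (simp add: pot)
      qed
    qed
  qed
qed

lemma potential_cong:
  assumes C: "signed_graph C" and q: "potential C n q"
    and pq: "\<And>v. v \<in> verts C \<Longrightarrow> int n dvd p v - q v"
  shows "potential C n p"
  unfolding potential_def potential_at_def
proof (intro ballI allI impI)
  fix e i u assume e: "e \<in> edges C" and u: "attach C e i = Some u"
  have q_e: "int n dvd (case attach C e (\<not> i) of None \<Rightarrow> q u | Some v \<Rightarrow> q u - esign C e * q v)"
    using q e u by (simp add: potential_def potential_at_def)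
  have pq': "int n dvd p v - q v" if "attach C e j = Some v" for j v
    using pq signed_graph.attach_verts[OF C e that] by blast
  show "int n dvd (case attach C e (\<not> i) of None \<Rightarrow> p u | Some v \<Rightarrow> p u - esign C e * p v)"
  proof (cases "attach C e (\<not> i)")
    case None
    have "int n dvd (p u - q u) + q u" using q_e None by (intro dvd_add[OF pq'[OF u]]) simp
    with None show ?thesis by simp
  next
    case (Some v)
    have "int n dvd (p u - q u) + ((q u - esign C e * q v) - esign C e * (p v - q v))"
      using q_e Some by (intro dvd_add[OF pq'[OF u] dvd_diff[OF _ dvd_mult[OF pq'[OF Some]]]]) simp
    also have "\<dots> = p u - esign C e * p v" by (simp add: algebra_simps)
    finally show ?thesis using Some by simp
  qed
qed

lemma potential_diff:
  assumes "potential G n p" "potential G n q"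
  shows "potential G n (\<lambda>v. p v - q v)"
  unfolding potential_def potential_at_def
proof (intro ballI allI impI)
  fix e i u assume "e \<in> edges G" "attach G e i = Some u"
  then have *: "int n dvd (case attach G e (\<not> i) of None \<Rightarrow> p u | Some v \<Rightarrow> p u - esign G e * p v)"
    "int n dvd (case attach G e (\<not> i) of None \<Rightarrow> q u | Some v \<Rightarrow> q u - esign G e * q v)"
    using assms by (simp_all add: potential_def potential_at_def)
  show "int n dvd (case attach G e (\<not> i) of None \<Rightarrow> p u - q u
      | Some v \<Rightarrow> p u - q u - esign G e * (p v - q v))"
    using dvd_diff[OF *] by (cases "attach G e (\<not> i)") (simp_all add: algebra_simps)
qed

lemma potential_edge:
  assumes "potential G n p" "e \<in> edges G" "attach G e i = Some u" "attach G e (\<not> i) = Some v"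
  shows "int n dvd p u - esign G e * p v"
proof -
  have "int n dvd (case attach G e (\<not> i) of None \<Rightarrow> p u | Some v \<Rightarrow> p u - esign G e * p v)"
    using assms unfolding potential_def potential_at_def by blast
  then show ?thesis using assms(4) by simp
qed

text \<open>
  Along a walk, a potential only changes by signs. So it is determined up to sign by its value at one
  vertex; that the sign also agrees for two potentials comes from applying this to their
  difference.
\<close>

lemma potential_connected:
  assumes G: "signed_graph G" and p: "potential G n p" and uv: "(u, v) \<in> connectivity G"
  shows "int n dvd p v - p u \<or> int n dvd p v + p u"
proof -
  have "(u, v) \<in> (adjacency G)\<^sup>*" using uv by (simp add: connectivity_def)
  then show ?thesis
  proof (induction rule: rtrancl_induct)
    case (step v w)
    then obtain e i where e: "e \<in> edges G" "attach G e i = Some v" "attach G e (\<not> i) = Some w"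
      by (auto simp: adjacency_def)
    have "int n dvd p v - esign G e * p w" by (rule potential_edge[OF p e])
    moreover have "esign G e = 1 \<or> esign G e = -1" using signed_graph.esign_pm[OF G e(1)] by simp
    ultimately have vw: "int n dvd p v - p w \<or> int n dvd p v + p w" by auto
    have "int n dvd p w - p u \<longleftrightarrow> int n dvd p u - p w" by (rule dvd_diff_commute)
    moreover have "int n dvd p w + p u" if "int n dvd p v - p w" "int n dvd p v + p u"
      using dvd_diff[OF that(2,1)] by (simp add: add.commute)
    moreover have "int n dvd p w - p u" if "int n dvd p v - p w" "int n dvd p v - p u"
      using dvd_diff[OF that(2,1)] by simp
    moreover have "int n dvd p w + p u" if "int n dvd p v + p w" "int n dvd p v - p u"
      using dvd_diff[OF that] by (simp add: add.commute)
    moreover have "int n dvd p w - p u" if "int n dvd p v + p w" "int n dvd p v + p u"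
      using dvd_diff[OF that] by simp
    ultimately show ?case using step.IH vw by blast
  qed simp
qed

section \<open>Counting potentials component by component\<close>

lemma potential_at_component [simp]: "potential_at (component_of G W) n p = potential_at G n p"
  by (simp add: fun_eq_iff potential_at_def cong: option.case_cong)

lemma potential_component_iff:
  "potential (component_of G W) n p \<longleftrightarrow>
     (\<forall>e\<in>edges G. (\<exists>i. \<exists>v\<in>W. attach G e i = Some v) \<longrightarrow> potential_at G n p e)"
  by (auto simp: potential_def)

lemma potential_iff_components:
  assumes G: "signed_graph G"
  shows "potential G n p \<longleftrightarrow> (\<forall>W\<in>verts G // connectivity G. potential (component_of G W) n p)"
proof
  assume R: "\<forall>W\<in>verts G // connectivity G. potential (component_of G W) n p"
  show "potential G n p" unfolding potential_def
  proof
    fix e assume e: "e \<in> edges G"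
    then obtain i v where iv: "attach G e i = Some v" using signed_graph.attach_some[OF G] by blast
    then have "v \<in> verts G" by (rule signed_graph.attach_verts[OF G e])
    then have "connectivity G `` {v} \<in> verts G // connectivity G" "v \<in> connectivity G `` {v}"
      using equiv_class_self[OF equiv_connectivity] by (auto intro: quotientI)
    then show "potential_at G n p e" using R e iv unfolding potential_component_iff by blast
  qed
qed (auto simp: potential_component_iff potential_def)

text \<open>
  The values that a potential of the component \<open>C\<close> may take at a chosen vertex. Since a component
  with an outer-edge is unbalanced, the three cases are: everything, 2-torsion, and 0.
\<close>

definition root_values :: "('v, 'e) sgraph \<Rightarrow> nat \<Rightarrow> int set" where
  "root_values C n = {a \<in> {0..<int n}.
     (\<not> balanced C \<longrightarrow> int n dvd 2 * a) \<and> ((\<exists>e. outer_edge C e) \<longrightarrow> a = 0)}"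

text \<open>
  Suppose that there is no outer-edge and that \<open>2 * p r\<close> does not vanish. Then \<open>p r\<close> and \<open>- p r\<close> are
  distinct, and every value of \<open>p\<close> in the component is exactly one of them; the resulting signs
  form a switching, so the component is balanced. An outer-edge makes \<open>p\<close> vanish at its vertex and
  hence everywhere in the component.
\<close>

lemma root_value_of_potential:
  assumes G: "signed_graph G" and W: "W \<in> verts G // connectivity G" and r: "r \<in> W"
    and p: "potential G n p" and range: "p r \<in> {0..<int n}"
  shows "p r \<in> root_values (component_of G W) n"
proof -
  let ?C = "component_of G W"
  have conn: "int n dvd p v - p r \<or> int n dvd p v + p r" if "v \<in> W" for v
    using potential_connected[OF G p class_connected[OF W r that]] .
  have tor: "int n dvd 2 * p r" if nb: "\<not> balanced ?C"  and closed: "\<forall>e. \<not> outer_edge ?C e"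
  proof (rule ccontr)
    assume not_tor: "\<not> int n dvd 2 * p r"
    define s :: "'a \<Rightarrow> int" where "s v = (if int n dvd p v - p r then 1 else -1)" for v
    have s: "int n dvd p v - s v * p r" if "v \<in> W" for v using conn[OF that] by (auto simp: s_def)
    have s_pm: "s v = 1 \<or> s v = -1" for v by (simp add: s_def)
    have "switches ?C (edges ?C) s" unfolding switches_def
    proof (intro conjI allI ballI)
      fix e assume e: "e \<in> edges ?C"
      note sgC = signed_graph_component[OF G W]
      let ?u = "end_of ?C e False" and ?v = "end_of ?C e True"
      have att: "attach G e False = Some ?u" "attach G e True = Some ?v"
        using attach_end_of[OF sgC closed e, of False] attach_end_of[OF sgC closed e, of True] by auto
      have W_uv: "?u \<in> W" "?v \<in> W"
        using signed_graph.attach_verts[OF sgC e] att by auto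
      have \<sigma>: "esign G e = 1 \<or> esign G e = -1" using signed_graph.esign_pm[OF sgC e] by simp
      have "int n dvd p ?u - esign G e * p ?v"
        using e att by (intro potential_edge[OF p, of e False]) auto
      then have "int n dvd (p ?u - esign G e * p ?v) - (p ?u - s ?u * p r) + esign G e * (p ?v - s ?v * p r)"
        by (rule dvd_add[OF dvd_diff[OF _ s[OF W_uv(1)]] dvd_mult[OF s[OF W_uv(2)]]])
      also have "\<dots> = (s ?u - esign G e * s ?v) * p r" by (simp add: algebra_simps)
      finally have "int n dvd (s ?u - esign G e * s ?v) * p r" .
      moreover have "int n dvd - 2 * p r \<longleftrightarrow> int n dvd 2 * p r"
        using dvd_minus_iff[of "int n" "2 * p r"] by simp
      ultimately show "s ?u * s ?v = esign ?C e"
        using s_pm[of ?u] s_pm[of ?v] \<sigma> not_tor by auto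
    qed (use s_pm in auto)
    then show False using nb closed balanced_iff_switching[OF signed_graph_component[OF G W]] by blast
  qed
  have zero: "p r = 0" if outer: "outer_edge ?C e" for e
  proof -
    obtain i v where i: "attach G e i = Some v" and uniq: "\<And>j. attach G e j \<noteq> None \<Longrightarrow> j = i"
      using outer unfolding outer_edge_def by auto
    then have "attach G e (\<not> i) = None" by (metis (full_types))
    moreover have e: "e \<in> edges ?C" using outer by (simp add: outer_edge_def)
    ultimately have v0: "int n dvd p v"
      using p i by (force simp: potential_def potential_at_def)
    have "v \<in> W"
      using signed_graph.attach_verts[OF signed_graph_component[OF G W] e] i by auto
    then have "int n dvd p r"
      using conn[of v] dvd_diff[OF v0, of "p v - p r"] dvd_diff[OF _ v0, of "p v + p r"] by auto
    then show ?thesis using range zdvd_not_zless[of "p r" "int n"] by (cases "p r > 0") auto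
  qed
  show ?thesis
  proof (cases "\<exists>e. outer_edge ?C e")
    case True
    then have "p r = 0" using zero by blast
    then show ?thesis using range by (simp add: root_values_def)
  next
    case False
    then show ?thesis using range tor by (simp add: root_values_def)
  qed
qed

text \<open>
  In a balanced component, a switching multiplied by \<open>a\<close> is a potential. Otherwise \<open>a\<close> equals its
  own negative, so the constant function \<open>a\<close> satisfies the condition of every edge irrespective
  of its sign.
\<close>

lemma potential_with_root_value:
  assumes C: "signed_graph C" and a: "a \<in> root_values C n"
  shows "\<exists>h. potential C n h \<and> h r = a"
proof (cases "balanced C")
  case True
  then obtain s where closed: "\<forall>e. \<not> outer_edge C e" and s: "switches C (edges C) s"
    using balanced_iff_switching[OF C] by blast
  have pm: "s v = 1 \<or> s v = -1" for v using s by (simp add: switches_def)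
  have "potential C n (\<lambda>v. a * s r * s v)"
    unfolding potential_def potential_at_def
  proof (intro ballI allI impI)
    fix e i u assume e: "e \<in> edges C" and u: "attach C e i = Some u"
    let ?v = "end_of C e (\<not> i)"
    have v: "attach C e (\<not> i) = Some ?v" by (rule attach_end_of[OF C closed e])
    have "s u * s ?v = esign C e"
      using s e u by (cases i) (auto simp: switches_def end_of_def mult.commute)
    then have "s u = esign C e * s ?v" using pm[of ?v] by auto
    then show "int n dvd (case attach C e (\<not> i) of None \<Rightarrow> a * s r * s u
        | Some v \<Rightarrow> a * s r * s u - esign C e * (a * s r * s v))"
      by (simp add: v)
  qed
  then show ?thesis using pm[of r] by (intro exI[of _ "\<lambda>v. a * s r * s v"]) auto
next
  case False
  have "potential C n (\<lambda>_. a)"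
    unfolding potential_def potential_at_def
  proof (intro ballI allI impI)
    fix e i u assume e: "e \<in> edges C" and u: "attach C e i = Some u"
    have tor: "int n dvd 2 * a" using a False by (simp add: root_values_def)
    have \<sigma>: "esign C e = 1 \<or> esign C e = -1" using signed_graph.esign_pm[OF C e] by simp
    show "int n dvd (case attach C e (\<not> i) of None \<Rightarrow> a | Some v \<Rightarrow> a - esign C e * a)"
    proof (cases "attach C e (\<not> i)")
      case None
      then have "j = i" if "attach C e j \<noteq> None" for j using that by (cases "j = i") auto
      then have "outer_edge C e" using e u by (auto simp: outer_edge_def)
      then show ?thesis using a None by (auto simp: root_values_def)
    qed (use tor \<sigma> in auto)
  qed
  then show ?thesis by blast
qed

lemma card_two_torsion:
  assumes "n > 0"
  shows "card {a \<in> {0..<int n}. int n dvd 2 * a} = (if odd n then 1 else 2)"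
proof (cases "odd n")
  case True
  have "{a \<in> {0..<int n}. int n dvd 2 * a} = {0}"
  proof (intro equalityI subsetI)
    fix a assume a: "a \<in> {a \<in> {0..<int n}. int n dvd 2 * a}"
    have "coprime (int n) 2" using True by simp
    then have "int n dvd a" using a coprime_dvd_mult_right_iff[of "int n" 2 a] by simp
    then show "a \<in> {0}" using a zdvd_not_zless[of a "int n"] by (cases "a > 0") auto
  qed (use assms in auto)
  with True show ?thesis by simp
next
  case False
  then obtain m where m: "n = 2 * m" by (auto elim: evenE)
  have "{a \<in> {0..<int n}. int n dvd 2 * a} = {0, int m}"
  proof (intro equalityI subsetI)
    fix a assume a: "a \<in> {a \<in> {0..<int n}. int n dvd 2 * a}"
    then have "int m dvd a" by (simp add: m)
    then obtain k where k: "a = int m * k" by (elim dvdE)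
    have "0 \<le> k" "k < 2" using a assms
      by (auto simp: k m zero_le_mult_iff mult_less_cancel_left mult.commute)
    then have "k = 0 \<or> k = 1" by linarith
    then show "a \<in> {0, int m}" by (auto simp: k)
  qed (use assms m in auto)
  with False assms m show ?thesis by simp
qed

lemma card_root_values:
  assumes "signed_graph C" "n > 0"
  shows "card (root_values C n) = (if balanced C then n
    else if \<forall>e. \<not> outer_edge C e then (if odd n then 1 else 2) else 1)"
proof -
  consider "balanced C" "\<forall>e. \<not> outer_edge C e" | "\<not> balanced C" "\<forall>e. \<not> outer_edge C e"
    | "\<not> balanced C" "\<exists>e. outer_edge C e"
    by (auto simp: balanced_def)
  then show ?thesis
  proof cases
    case 1
    then have "root_values C n = {0..<int n}" by (auto simp: root_values_def)
    with 1 show ?thesis by simp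
  next
    case 3
    then have "root_values C n = {0}" using assms(2) by (auto simp: root_values_def)
    with 3 show ?thesis by auto
  qed (use card_two_torsion[OF assms(2)] in \<open>auto simp: root_values_def\<close>)
qed

text \<open>
  Evaluation at one chosen vertex of each component is a bijection from the potentials onto the
  families of admissible values.
\<close>

lemma card_potentials:
  assumes G: "signed_graph G" and n: "n > 0"
  shows "card {p \<in> verts G \<rightarrow>\<^sub>E {0..<int n}. potential G n p}
    = n ^ balanced_comps G * (if odd n then 1 else 2) ^ closed_unbalanced_comps G"
proof -
  define Q where "Q = verts G // connectivity G"
  define root where "root W = (SOME r. r \<in> W)" for W :: "'a set"
  let ?P = "{p \<in> verts G \<rightarrow>\<^sub>E {0..<int n}. potential G n p}"
  let ?R = "\<Pi>\<^sub>E W\<in>Q. root_values (component_of G W) n"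
  have finV: "finite (verts G)" using G by (simp add: signed_graph_def)
  have finQ: "finite Q" unfolding Q_def
    by (rule finite_quotient[OF finV]) (auto simp: connectivity_def)
  have root: "root W \<in> W" if "W \<in> Q" for W
    using that in_quotient_imp_non_empty[OF equiv_connectivity] unfolding Q_def root_def
    by (metis some_in_eq)
  have rootV: "root W \<in> verts G" if "W \<in> Q" for W
    using root[OF that] class_subset that by (auto simp: Q_def)
  have "bij_betw (\<lambda>p. \<lambda>W\<in>Q. p (root W)) ?P ?R"
  proof (rule bij_betw_imageI)
    show "inj_on (\<lambda>p. \<lambda>W\<in>Q. p (root W)) ?P"
    proof (rule inj_onI)
      fix p q assume p: "p \<in> ?P" and q: "q \<in> ?P"
        and eq: "(\<lambda>W\<in>Q. p (root W)) = (\<lambda>W\<in>Q. q (root W))"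
      show "p = q"
      proof (rule PiE_ext)
        show "p \<in> verts G \<rightarrow>\<^sub>E {0..<int n}" "q \<in> verts G \<rightarrow>\<^sub>E {0..<int n}" using p q by auto
        fix v assume v: "v \<in> verts G"
        let ?W = "connectivity G `` {v}"
        have W: "?W \<in> Q" "v \<in> ?W" using v equiv_class_self[OF equiv_connectivity]
          by (auto simp: Q_def intro: quotientI)
        have "(root ?W, v) \<in> connectivity G"
          using class_connected W root[OF W(1)] by (metis Q_def)
        moreover have "p (root ?W) = q (root ?W)" using fun_cong[OF eq, of ?W] W(1) by simp
        ultimately have "int n dvd p v - q v"
          using potential_connected[OF G potential_diff, of n p q "root ?W" v] p q by auto
        moreover have "p v \<in> {0..<int n}" "q v \<in> {0..<int n}" using p q v by auto
        ultimately show "p v = q v"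
          by (metis atLeastLessThan_iff mod_eq_dvd_iff mod_pos_pos_trivial)
      qed
    qed
    show "(\<lambda>p. \<lambda>W\<in>Q. p (root W)) ` ?P = ?R"
    proof (intro equalityI image_subsetI subsetI)
      fix p assume p: "p \<in> ?P"
      show "(\<lambda>W\<in>Q. p (root W)) \<in> ?R"
      proof (rule restrict_PiE_iff[THEN iffD2], rule ballI)
        fix W assume W: "W \<in> Q"
        show "p (root W) \<in> root_values (component_of G W) n"
          using W root p rootV by (intro root_value_of_potential[OF G]) (auto simp: Q_def)
      qed
    next
      fix b assume b: "b \<in> ?R"
      have "\<forall>W\<in>Q. \<exists>h. potential (component_of G W) n h \<and> h (root W) = b W"
        using b by (intro ballI potential_with_root_value)
          (auto simp: Q_def intro: signed_graph_component[OF G])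
      then obtain h where h: "\<And>W. W \<in> Q \<Longrightarrow> potential (component_of G W) n (h W)"
        and h_root: "\<And>W. W \<in> Q \<Longrightarrow> h W (root W) = b W" by metis
      define p where "p = (\<lambda>v\<in>verts G. h (connectivity G `` {v}) v mod int n)"
      have p_W: "p v = h W v mod int n" if "W \<in> Q" "v \<in> W" for W v
      proof -
        have "v \<in> verts G" using that class_subset by (auto simp: Q_def)
        moreover have "connectivity G `` {v} = W"
          using that unfolding Q_def
          by (metis Image_singleton_iff class_connected equiv_class_eq_iff equiv_connectivity quotientE)
        ultimately show ?thesis by (simp add: p_def)
      qed
      have "potential G n p" unfolding potential_iff_components[OF G]
      proof
        fix W assume W: "W \<in> verts G // connectivity G"
        show "potential (component_of G W) n p"
        proof (rule potential_cong[OF signed_graph_component[OF G W] h])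
          show "int n dvd p v - h W v" if "v \<in> verts (component_of G W)" for v
            using that W p_W[of W v] by (simp add: Q_def mod_eq_dvd_iff[symmetric])
        qed (use W in \<open>simp add: Q_def\<close>)
      qed
      moreover have "p \<in> verts G \<rightarrow>\<^sub>E {0..<int n}" using n by (auto simp: p_def)
      moreover have "b = (\<lambda>W\<in>Q. p (root W))"
      proof (rule PiE_ext[OF b])
        have bW: "b W \<in> {0..<int n}" if "W \<in> Q" for W
          using PiE_mem[OF b that] by (simp add: root_values_def)
        show p_root: "b W = (\<lambda>W\<in>Q. p (root W)) W" if "W \<in> Q" for W
          using bW[OF that] that p_W[OF that root[OF that]] h_root[OF that] by simp
        show "(\<lambda>W\<in>Q. p (root W)) \<in> ?R"
          unfolding restrict_PiE_iff
        proof
          fix W assume "W \<in> Q"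
          then show "p (root W) \<in> root_values (component_of G W) n"
            using p_root[of W] PiE_mem[OF b, of W] by simp
        qed
      qed
      ultimately show "b \<in> (\<lambda>p. \<lambda>W\<in>Q. p (root W)) ` ?P" by blast
    qed
  qed
  then have "card ?P = card ?R" by (rule bij_betw_same_card)
  also have "\<dots> = (\<Prod>W\<in>Q. card (root_values (component_of G W) n))"
    by (rule card_PiE[OF finQ])
  also have "\<dots> = (\<Prod>W\<in>Q. (if balanced (component_of G W) then n else 1) *
      (if \<not> balanced (component_of G W) \<and> (\<forall>e. \<not> outer_edge (component_of G W) e)
       then (if odd n then 1 else 2) else 1))"
    using card_root_values[OF signed_graph_component[OF G] n] by (intro prod.cong) (auto simp: Q_def)
  also have "\<dots> = n ^ card {W \<in> Q. balanced (component_of G W)} *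
      (if odd n then 1 else 2) ^ card {W \<in> Q. \<not> balanced (component_of G W) \<and>
        (\<forall>e. \<not> outer_edge (component_of G W) e)}"
    using finQ by (simp add: prod.distrib prod.If_cases Int_def)
  also have "card {W \<in> Q. balanced (component_of G W)} = balanced_comps G"
  proof -
    have "{C \<in> components G. balanced C} = component_of G ` {W \<in> Q. balanced (component_of G W)}"
      by (auto simp: components_eq Q_def)
    then show ?thesis by (simp add: balanced_comps_def card_image inj_component_of)
  qed
  also have "card {W \<in> Q. \<not> balanced (component_of G W) \<and>
        (\<forall>e. \<not> outer_edge (component_of G W) e)} = closed_unbalanced_comps G"
  proof -
    have "{C \<in> components G. \<not> balanced C \<and> (\<forall>e. \<not> outer_edge C e)} = component_of G `
        {W \<in> Q. \<not> balanced (component_of G W) \<and> (\<forall>e. \<not> outer_edge (component_of G W) e)}"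
      by (auto simp: components_eq Q_def)
    then show ?thesis by (simp add: closed_unbalanced_comps_def card_image inj_component_of)
  qed
  finally show ?thesis .
qed

section \<open>Flows over the integers modulo n as weights on edges\<close>

text \<open>
  The arrow of one end is chosen arbitrarily; the sign of the edge dictates the other.
\<close>

definition default_arc :: "('v, 'e) sgraph \<Rightarrow> 'e \<Rightarrow> 'e arc" where
  "default_arc G e = (e, \<lambda>i. if i then - esign G e else 1)"

lemma fst_default_arc [simp]: "fst (default_arc G e) = e"
  by (simp add: default_arc_def)

lemma fst_rev_arc [simp]: "fst (rev_arc a) = fst a"
  by (cases a) simp

lemma rev_rev_arc [simp]: "rev_arc (rev_arc a) = a"
  by (cases a) simp

lemma rev_default_arc_neq: "rev_arc (default_arc G e) \<noteq> default_arc G e'"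
proof
  assume "rev_arc (default_arc G e) = default_arc G e'"
  then have "snd (rev_arc (default_arc G e)) False = snd (default_arc G e') False" by simp
  then show False by (simp add: default_arc_def)
qed

lemma arcs_of_eq:
  assumes "signed_graph G" "e \<in> edges G"
  shows "arcs_of G e = {default_arc G e, rev_arc (default_arc G e)}"
proof -
  have \<sigma>: "esign G e = 1 \<or> esign G e = -1" using signed_graph.esign_pm[OF assms] by simp
  show ?thesis
  proof (intro equalityI subsetI)
    fix a assume "a \<in> arcs_of G e"
    then obtain \<tau> where a: "a = (e, \<tau>)" and pm: "\<tau> False = 1 \<or> \<tau> False = -1"
      and dir: "if esign G e = 1 then \<tau> True = - \<tau> False else \<tau> True = \<tau> False"
      by (auto simp: arcs_of_def)
    have "\<tau> True = - esign G e * \<tau> False" using \<sigma> dir by auto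
    then have "\<tau> = (\<lambda>i. if i then - esign G e * \<tau> False else \<tau> False)"
      by (auto simp: fun_eq_iff all_bool_eq)
    then show "a \<in> {default_arc G e, rev_arc (default_arc G e)}"
      using pm by (auto simp: a default_arc_def fun_eq_iff all_bool_eq)
  qed (use \<sigma> in \<open>auto simp: arcs_of_def default_arc_def\<close>)
qed

lemma arcs_cases:
  assumes "signed_graph G" "a \<in> arcs G"
  obtains e where "e \<in> edges G" "a = default_arc G e" | e where "e \<in> edges G" "a = rev_arc (default_arc G e)"
  using assms(2) arcs_of_eq[OF assms(1)] by (auto simp: arcs_def)

lemma default_arc_in_arcs:
  assumes "signed_graph G" "e \<in> edges G"
  shows "default_arc G e \<in> arcs G" "rev_arc (default_arc G e) \<in> arcs G"
  using assms(2) arcs_of_eq[OF assms] by (auto simp: arcs_def)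

lemma incidence_rev_arc: "incidence G v (rev_arc a) = - incidence G v a"
  by (cases a) simp

lemma finprod_integer_mod_group:
  assumes "finite A" "\<And>x. x \<in> A \<Longrightarrow> f x \<in> carrier (integer_mod_group n)"
  shows "finprod (integer_mod_group n) f A = (\<Sum>x\<in>A. f x) mod int n"
proof -
  interpret comm_group "integer_mod_group n" by simp
  show ?thesis using assms
  proof (induction A rule: finite_induct)
    case (insert x A)
    then show ?case by (simp add: Pi_def mod_add_right_eq)
  qed simp
qed

text \<open>
  Conservation at every vertex of \<open>G\<close> for a weighting that is understood to be 0 outside \<open>S\<close>.
\<close>

definition conserved :: "('v, 'e) sgraph \<Rightarrow> nat \<Rightarrow> 'e set \<Rightarrow> ('e \<Rightarrow> int) \<Rightarrow> bool" where
  "conserved G n S g \<longleftrightarrow>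
     (\<forall>v\<in>verts G. int n dvd (\<Sum>e\<in>S. incidence G v (default_arc G e) * g e))"

text \<open>
  Replacing an arc by its inverse negates both the incidence number and the flow value, so
  conservation for the default arcs implies it for every choice of arcs.
\<close>

lemma in_flows_iff:
  assumes G: "signed_graph G" and n: "n > 0"
  shows "f \<in> flows G (integer_mod_group n) \<longleftrightarrow>
    f \<in> arcs G \<rightarrow>\<^sub>E {0..<int n} \<and> (\<forall>a\<in>arcs G. f (rev_arc a) = (- f a) mod int n) \<and>
    conserved G n (edges G) (\<lambda>e. f (default_arc G e))"
proof (cases "f \<in> arcs G \<rightarrow>\<^sub>E {0..<int n} \<and> (\<forall>a\<in>arcs G. f (rev_arc a) = (- f a) mod int n)")
  case True
  have carrier: "carrier (integer_mod_group n) = {0..<int n}"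
    using n by (simp add: carrier_integer_mod_group)
  have finE: "finite (edges G)" using G by (simp add: signed_graph_def)
  have prod: "(\<Otimes>\<^bsub>integer_mod_group n\<^esub>e\<in>edges G. f (d e) [^]\<^bsub>integer_mod_group n\<^esub> incidence G v (d e))
      = (\<Sum>e\<in>edges G. incidence G v (default_arc G e) * f (default_arc G e)) mod int n"
    if d: "\<forall>e\<in>edges G. d e \<in> arcs_of G e" for d v
  proof -
    have "(\<Otimes>\<^bsub>integer_mod_group n\<^esub>e\<in>edges G. f (d e) [^]\<^bsub>integer_mod_group n\<^esub> incidence G v (d e))
        = (\<Sum>e\<in>edges G. (incidence G v (d e) * f (d e)) mod int n) mod int n"
      using n by (subst finprod_integer_mod_group[OF finE]) (simp_all add: carrier int_pow_integer_mod_group)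
    also have "(\<Sum>e\<in>edges G. (incidence G v (d e) * f (d e)) mod int n)
        = (\<Sum>e\<in>edges G. (incidence G v (default_arc G e) * f (default_arc G e)) mod int n)"
    proof (rule sum.cong[OF refl])
      fix e assume e: "e \<in> edges G"
      let ?a = "default_arc G e"
      have "f (rev_arc ?a) = (- f ?a) mod int n"
        using True default_arc_in_arcs[OF G e] by blast
      then have "(incidence G v (rev_arc ?a) * f (rev_arc ?a)) mod int n
          = (- incidence G v ?a * ((- f ?a) mod int n)) mod int n"
        by (simp add: incidence_rev_arc)
      also have "\<dots> = (incidence G v ?a * f ?a) mod int n"
        by (subst mod_mult_right_eq) simp
      finally have rev: "(incidence G v (rev_arc ?a) * f (rev_arc ?a)) mod int n
          = (incidence G v ?a * f ?a) mod int n" .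
      have "d e = ?a \<or> d e = rev_arc ?a" using d e arcs_of_eq[OF G e] by blast
      then show "(incidence G v (d e) * f (d e)) mod int n = (incidence G v ?a * f ?a) mod int n"
        using rev by fastforce
    qed
    finally show ?thesis by (simp add: mod_sum_eq)
  qed
  have "(\<forall>e\<in>edges G. default_arc G e \<in> arcs_of G e)" using arcs_of_eq[OF G] by simp
  then have "(\<forall>d. (\<forall>e\<in>edges G. d e \<in> arcs_of G e) \<longrightarrow> (\<forall>v\<in>verts G.
      (\<Otimes>\<^bsub>integer_mod_group n\<^esub>e\<in>edges G. f (d e) [^]\<^bsub>integer_mod_group n\<^esub> incidence G v (d e))
        = \<one>\<^bsub>integer_mod_group n\<^esub>))
      \<longleftrightarrow> conserved G n (edges G) (\<lambda>e. f (default_arc G e))"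
    using prod by (auto simp: conserved_def dvd_eq_mod_eq_0)
  moreover have "inv\<^bsub>integer_mod_group n\<^esub> f a = (- f a) mod int n" if "a \<in> arcs G" for a
    using True that by (intro inv_integer_mod_group) (auto simp: carrier)
  ultimately show ?thesis using True by (auto simp: flows_def carrier)
next
  case False
  have carrier: "carrier (integer_mod_group n) = {0..<int n}"
    using n by (simp add: carrier_integer_mod_group)
  have "inv\<^bsub>integer_mod_group n\<^esub> f a = (- f a) mod int n"
    if "f \<in> arcs G \<rightarrow>\<^sub>E {0..<int n}" "a \<in> arcs G" for a
    using that by (intro inv_integer_mod_group) (auto simp: carrier)
  with False show ?thesis by (auto simp: flows_def carrier)
qed

text \<open>
  A flow is determined by its values on the default arcs, and any weighting of the edges extends
  to the inverse arcs by antisymmetry.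
\<close>

lemma card_nz_flows:
  assumes G: "signed_graph G" and n: "n > 0"
  shows "card (nz_flows G (integer_mod_group n))
    = card {g \<in> edges G \<rightarrow>\<^sub>E {0..<int n}. conserved G n (edges G) g \<and> (\<forall>e\<in>edges G. g e \<noteq> 0)}"
    (is "_ = card ?N")
proof -
  let ?F = "\<lambda>f. \<lambda>e\<in>edges G. f (default_arc G e)"
  have conserved_cong: "conserved G n (edges G) (?F f) \<longleftrightarrow> conserved G n (edges G) (\<lambda>e. f (default_arc G e))" for f
    by (simp add: conserved_def)
  have "bij_betw ?F (nz_flows G (integer_mod_group n)) ?N"
  proof (rule bij_betw_imageI)
    show "inj_on ?F (nz_flows G (integer_mod_group n))"
    proof (rule inj_onI)
      fix f f' assume f: "f \<in> nz_flows G (integer_mod_group n)" "f' \<in> nz_flows G (integer_mod_group n)"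
        and eq: "?F f = ?F f'"
      have eq': "f (default_arc G e) = f' (default_arc G e)" if "e \<in> edges G" for e
        using fun_cong[OF eq, of e] that by simp
      note ff = f[unfolded nz_flows_def mem_Collect_eq in_flows_iff[OF G n]]
      show "f = f'"
      proof (rule PiE_ext)
        show "f \<in> arcs G \<rightarrow>\<^sub>E {0..<int n}" "f' \<in> arcs G \<rightarrow>\<^sub>E {0..<int n}" using ff by auto
        fix a assume "a \<in> arcs G"
        with G show "f a = f' a"
        proof (cases rule: arcs_cases)
          case (2 e)
          then show ?thesis
            using ff default_arc_in_arcs(1)[OF G] eq' by simp
        qed (use eq' in simp)
      qed
    qed
    show "?F ` nz_flows G (integer_mod_group n) = ?N"
    proof (intro equalityI image_subsetI subsetI)
      fix f assume "f \<in> nz_flows G (integer_mod_group n)"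
      note ff = this[unfolded nz_flows_def mem_Collect_eq in_flows_iff[OF G n]]
      have "?F f \<in> edges G \<rightarrow>\<^sub>E {0..<int n}"
        unfolding restrict_PiE_iff using ff default_arc_in_arcs[OF G] by blast
      then show "?F f \<in> ?N"
        using ff default_arc_in_arcs[OF G] by (simp add: conserved_cong)
    next
      fix g assume g: "g \<in> ?N"
      define f where "f = (\<lambda>a\<in>arcs G. if a = default_arc G (fst a) then g (fst a) else (- g (fst a)) mod int n)"
      have f1: "f (default_arc G e) = g e" and f2: "f (rev_arc (default_arc G e)) = (- g e) mod int n"
        if "e \<in> edges G" for e
        using default_arc_in_arcs[OF G that] by (simp_all add: f_def rev_default_arc_neq)
      have g_range: "0 \<le> g e" "g e < int n" "g e \<noteq> 0" if "e \<in> edges G" for e using g that by auto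
      have neg: "(- g e) mod int n \<noteq> 0" if "e \<in> edges G" for e
        using g_range[OF that] by (simp add: zmod_zminus1_eq_if)
      have negneg: "(- ((- g e) mod int n)) mod int n = g e" if "e \<in> edges G" for e
        using g_range[OF that] by (simp add: mod_minus_eq)
      have "f \<in> arcs G \<rightarrow>\<^sub>E {0..<int n}"
      proof
        fix a assume "a \<in> arcs G"
        with G show "f a \<in> {0..<int n}"
          by (cases rule: arcs_cases) (use f1 f2 g_range n in auto)
      qed (simp add: f_def)
      moreover have "f (rev_arc a) = (- f a) mod int n" if "a \<in> arcs G" for a
        using G that by (cases rule: arcs_cases) (simp_all add: f1 f2 negneg)
      moreover have "f a \<noteq> 0" if "a \<in> arcs G" for a
        using G that by (cases rule: arcs_cases) (simp_all add: f1 f2 neg g_range)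
      moreover have "conserved G n (edges G) (\<lambda>e. f (default_arc G e))"
        using g by (simp add: conserved_def f1)
      ultimately have "f \<in> nz_flows G (integer_mod_group n)"
        by (simp add: nz_flows_def in_flows_iff[OF G n])
      moreover have "g = ?F f"
      proof (rule PiE_ext)
        show "g \<in> edges G \<rightarrow>\<^sub>E UNIV" "?F f \<in> edges G \<rightarrow>\<^sub>E UNIV" using g by auto
      qed (simp add: f1)
      ultimately show "g \<in> ?F ` nz_flows G (integer_mod_group n)" by blast
    qed
  qed
  then show ?thesis by (rule bij_betw_same_card)
qed

section \<open>Counting flows with prescribed support\<close>

text \<open>
  Written without division; that \<open>card (verts G)\<close> does not exceed the exponent on the right is
  itself a consequence of this count.
\<close>

lemma card_conserved_times_power:
  assumes G: "signed_graph G" and n: "n > 0"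
  shows "card {g \<in> edges G \<rightarrow>\<^sub>E {0..<int n}. conserved G n (edges G) g} * n ^ card (verts G)
    = (if odd n then 1 else 2) ^ closed_unbalanced_comps G * n ^ (card (edges G) + balanced_comps G)"
proof -
  have fin: "finite (verts G)" "finite (edges G)" using G by (auto simp: signed_graph_def)
  have "(\<forall>e\<in>edges G. int n dvd (\<Sum>v\<in>verts G. incidence G v (default_arc G e) * p v)) \<longleftrightarrow> potential G n p"
    for p
    using dvd_sum_incidence_iff_potential_at[OF G] arcs_of_eq[OF G] by (simp add: potential_def)
  then show ?thesis
    using card_kernel_mod[OF n fin, of "\<lambda>v e. incidence G v (default_arc G e)"] card_potentials[OF G n]
    by (simp add: conserved_def power_add mult_ac)
qed

text \<open>
  For odd \<open>n\<close> the factor coming from the 2-torsion is 1. As there is at least the zero flow, the count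
  for \<open>n = 3\<close> then compares two powers of 3.
\<close>

lemma card_verts_le:
  assumes G: "signed_graph G"
  shows "card (verts G) \<le> card (edges G) + balanced_comps G"
proof -
  let ?F = "{g \<in> edges G \<rightarrow>\<^sub>E {0..<int 3}. conserved G 3 (edges G) g}"
  have "finite ?F" using G by (simp add: signed_graph_def finite_PiE)
  moreover have "(\<lambda>e\<in>edges G. 0) \<in> ?F" by (simp add: conserved_def)
  ultimately have "card ?F \<ge> 1" by (metis One_nat_def Suc_leI card_gt_0_iff empty_iff)
  then have "3 ^ card (verts G) \<le> card ?F * 3 ^ card (verts G)" by simp
  also have "\<dots> = 3 ^ (card (edges G) + balanced_comps G)"
    using card_conserved_times_power[OF G, of 3] by simp
  finally show ?thesis by (rule power_le_imp_le_exp[rotated]) simp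
qed

lemma card_conserved:
  assumes G: "signed_graph G" and n: "n > 0"
  shows "card {g \<in> edges G \<rightarrow>\<^sub>E {0..<int n}. conserved G n (edges G) g}
    = (if odd n then 1 else 2) ^ closed_unbalanced_comps G
      * n ^ (card (edges G) + balanced_comps G - card (verts G))"
proof -
  have "card {g \<in> edges G \<rightarrow>\<^sub>E {0..<int n}. conserved G n (edges G) g} * n ^ card (verts G)
    = (if odd n then 1 else 2) ^ closed_unbalanced_comps G
      * n ^ (card (edges G) + balanced_comps G - card (verts G)) * n ^ card (verts G)"
    using card_conserved_times_power[OF G n] card_verts_le[OF G]
    by (simp add: power_add[symmetric] mult.assoc)
  then show ?thesis using n by simp
qed

lemma card_conserved_subset:
  assumes G: "signed_graph G" and n: "n > 0" and S: "S \<subseteq> edges G"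
  shows "card {g \<in> S \<rightarrow>\<^sub>E {0..<int n}. conserved G n S g}
    = (if odd n then 1 else 2) ^ closed_unbalanced_comps (G\<lparr>edges := S\<rparr>)
      * n ^ (card S + balanced_comps (G\<lparr>edges := S\<rparr>) - card (verts G))"
proof -
  have "signed_graph (G\<lparr>edges := S\<rparr>)"
    using G S by (auto simp: signed_graph_def intro: finite_subset)
  moreover have "conserved (G\<lparr>edges := S\<rparr>) n S g = conserved G n S g" for g
  proof -
    have "incidence (G\<lparr>edges := S\<rparr>) v a = incidence G v a" for v a by (cases a) simp
    moreover have "default_arc (G\<lparr>edges := S\<rparr>) e = default_arc G e" for e
      by (simp add: default_arc_def fun_eq_iff)
    ultimately show ?thesis by (simp add: conserved_def)
  qed
  ultimately show ?thesis using card_conserved[of "G\<lparr>edges := S\<rparr>" n] n by simp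
qed

section \<open>The flow polynomial\<close>

text \<open>
  The hypothesis of Moebius inversion over the subsets of \<open>S\<close>: conserved weightings of \<open>S\<close> are
  sorted by their supports.
\<close>

lemma card_conserved_eq_sum_supports:
  assumes S: "finite S" and n: "n > 0"
  shows "card {g \<in> S \<rightarrow>\<^sub>E {0..<int n}. conserved G n S g}
    = (\<Sum>T\<in>Pow S. card {g \<in> T \<rightarrow>\<^sub>E {0..<int n}. conserved G n T g \<and> (\<forall>e\<in>T. g e \<noteq> 0)})"
    (is "card (?F S) = (\<Sum>T\<in>Pow S. card (?N T))")
proof -
  have finF: "finite (?F S)" using S by (simp add: finite_PiE)
  have "card (?F S) = (\<Sum>T\<in>Pow S. \<Sum>g\<in>{g \<in> ?F S. {e \<in> S. g e \<noteq> 0} = T}. 1)"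
    by (subst sum.group[OF finF]) (use S in auto)
  also have "\<dots> = (\<Sum>T\<in>Pow S. card (?N T))"
  proof (rule sum.cong[OF refl])
    fix T assume "T \<in> Pow S"
    then have T: "T \<subseteq> S" by simp
    have sum_T: "(\<Sum>e\<in>S. c e * g e) = (\<Sum>e\<in>T. c e * h e)"
      if "\<And>e. e \<in> S - T \<Longrightarrow> g e = 0" "\<And>e. e \<in> T \<Longrightarrow> g e = h e" for c g h :: "_ \<Rightarrow> int"
      using S T that by (intro sum.mono_neutral_cong_right) auto
    have "bij_betw (\<lambda>g. restrict g T) {g \<in> ?F S. {e \<in> S. g e \<noteq> 0} = T} (?N T)"
    proof (rule bij_betw_byWitness[where f' = "\<lambda>g. \<lambda>e\<in>S. if e \<in> T then g e else 0"])
      show "\<forall>g\<in>{g \<in> ?F S. {e \<in> S. g e \<noteq> 0} = T}. (\<lambda>e\<in>S. if e \<in> T then restrict g T e else 0) = g"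
        by (auto simp: fun_eq_iff PiE_def extensional_def)
      show "\<forall>g\<in>?N T. restrict (\<lambda>e\<in>S. if e \<in> T then g e else 0) T = g"
        using T by (auto simp: fun_eq_iff PiE_def extensional_def)
      show "(\<lambda>g. restrict g T) ` {g \<in> ?F S. {e \<in> S. g e \<noteq> 0} = T} \<subseteq> ?N T"
      proof (rule image_subsetI)
        fix g assume g: "g \<in> {g \<in> ?F S. {e \<in> S. g e \<noteq> 0} = T}"
        have eqs: "(\<Sum>e\<in>S. incidence G v (default_arc G e) * g e)
            = (\<Sum>e\<in>T. incidence G v (default_arc G e) * restrict g T e)" for v
          by (rule sum_T) (use g in auto)
        have "conserved G n T (restrict g T)"
          using g unfolding conserved_def eqs[symmetric] by blast
        moreover have "restrict g T \<in> T \<rightarrow>\<^sub>E {0..<int n}"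
          unfolding restrict_PiE_iff using g T by blast
        moreover have "\<forall>e\<in>T. restrict g T e \<noteq> 0" using g by auto
        ultimately show "restrict g T \<in> ?N T" by blast
      qed
      show "(\<lambda>g. \<lambda>e\<in>S. if e \<in> T then g e else 0) ` ?N T \<subseteq> {g \<in> ?F S. {e \<in> S. g e \<noteq> 0} = T}"
      proof (rule image_subsetI)
        fix g assume g: "g \<in> ?N T"
        let ?h = "\<lambda>e\<in>S. if e \<in> T then g e else 0"
        have eqs: "(\<Sum>e\<in>S. incidence G v (default_arc G e) * ?h e)
            = (\<Sum>e\<in>T. incidence G v (default_arc G e) * g e)" for v
          by (rule sum_T) (use T in auto)
        have "conserved G n S ?h"
          using g unfolding conserved_def eqs by blast
        moreover have "?h \<in> S \<rightarrow>\<^sub>E {0..<int n}"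
          unfolding restrict_PiE_iff using g n by auto
        moreover have "{e \<in> S. ?h e \<noteq> 0} = T" using g T by auto
        ultimately show "?h \<in> {g \<in> ?F S. {e \<in> S. g e \<noteq> 0} = T}" by blast
      qed
    qed
    then show "(\<Sum>g\<in>{g \<in> ?F S. {e \<in> S. g e \<noteq> 0} = T}. 1) = card (?N T)"
      by (simp add: bij_betw_same_card)
  qed
  finally show ?thesis .
qed

text \<open>
  Each term of the flow polynomial evaluates to the number of flows with support in \<open>S\<close>, up to
  sign, and Moebius inversion over \<open>S\<close> extracts the flows whose support is the whole edge set.
\<close>

lemma poly_flow_poly:
  fixes G :: "('v, 'e) sgraph"
  assumes G: "signed_graph G" and n: "n > 0"
  shows "poly (poly (flow_poly G) (if odd n then 1 else 2)) (of_nat n :: 'k::comm_ring_1)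
    = of_nat (card (nz_flows G (integer_mod_group n)))"
proof -
  let ?t = "if odd n then 1 else 2 :: nat"
  let ?F = "\<lambda>S. {g \<in> S \<rightarrow>\<^sub>E {0..<int n}. conserved G n S g}"
  let ?N = "\<lambda>S. {g \<in> S \<rightarrow>\<^sub>E {0..<int n}. conserved G n S g \<and> (\<forall>e\<in>S. g e \<noteq> 0)}"
  have finE: "finite (edges G)" using G by (simp add: signed_graph_def)
  have t: "poly (if odd n then 1 else 2) (of_nat n :: 'k) = of_nat ?t" by simp
  have "poly (poly (flow_poly G) (if odd n then 1 else 2)) (of_nat n :: 'k)
      = (\<Sum>S\<in>Pow (edges G). (-1) ^ card (edges G - S) *
          (of_nat n ^ (card S + balanced_comps (G\<lparr>edges := S\<rparr>) - card (verts G))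
           * of_nat ?t ^ closed_unbalanced_comps (G\<lparr>edges := S\<rparr>)))"
    by (simp only: flow_poly_def Let_def poly_sum poly_mult poly_power poly_monom poly_minus poly_1 t
        mult_1_left)
  also have "\<dots> = (\<Sum>S\<in>Pow (edges G). (-1) ^ (card (edges G) - card S) * of_nat (card (?F S)))"
  proof (rule sum.cong[OF refl])
    fix S assume "S \<in> Pow (edges G)"
    then have S: "S \<subseteq> edges G" by simp
    show "(-1) ^ card (edges G - S) *
          (of_nat n ^ (card S + balanced_comps (G\<lparr>edges := S\<rparr>) - card (verts G))
           * of_nat ?t ^ closed_unbalanced_comps (G\<lparr>edges := S\<rparr>))
        = (-1) ^ (card (edges G) - card S) * (of_nat (card (?F S)) :: 'k)"
      unfolding card_conserved_subset[OF G n S] card_Diff_subset[OF finite_subset[OF S finE] S]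
      by (simp only: of_nat_mult of_nat_power mult.commute)
  qed
  also have "\<dots> = of_nat (card (?N (edges G)))"
    by (rule inclusion_exclusion_mobius[symmetric, where g = "\<lambda>S. of_nat (card (?F S))" and f = "\<lambda>S. of_nat (card (?N S))"])
       (simp_all add: finE card_conserved_eq_sum_supports[OF _ n])
  also have "\<dots> = of_nat (card (nz_flows G (integer_mod_group n)))"
    by (simp only: card_nz_flows[OF G n])
  finally show ?thesis .
qed

lemma poly_eq_if_eq_on_infinitely_many_nats:
  fixes p q :: "'k::{idom, ring_char_0} poly"
  assumes "infinite N" "\<And>n. n \<in> N \<Longrightarrow> poly p (of_nat n) = poly q (of_nat n)"
  shows "p = q"
proof (rule ccontr)
  assume "p \<noteq> q"
  then have "finite {x. poly (p - q) x = 0}" by (intro poly_roots_finite) simp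
  moreover have "of_nat ` N \<subseteq> {x. poly (p - q) x = 0}" using assms(2) by auto
  ultimately have "finite ((of_nat :: nat \<Rightarrow> 'k) ` N)" by (rule finite_subset[rotated])
  then have "finite N" by (rule finite_imageD) (simp add: inj_on_def)
  with assms(1) show False by blast
qed

theorem theorem6p4:
  fixes \<Sigma> :: "('v, 'e) sgraph"
  assumes "signed_graph \<Sigma>" and "edges \<Sigma> \<noteq> {}"
  shows "\<exists>(\<phi>odd :: 'k::{idom, ring_char_0} poly) (\<phi>even :: 'k poly).
    counts_odd_nz_flows \<Sigma> \<phi>odd \<and> (\<forall>p. counts_odd_nz_flows \<Sigma> p \<longrightarrow> p = \<phi>odd) \<and>
    counts_even_nz_flows \<Sigma> \<phi>even \<and> (\<forall>p. counts_even_nz_flows \<Sigma> p \<longrightarrow> p = \<phi>even) \<and>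
    \<phi>odd = poly (flow_poly \<Sigma>) 1 \<and> \<phi>even = poly (flow_poly \<Sigma>) 2"
proof (intro exI conjI)
  let ?odd = "poly (flow_poly \<Sigma>) 1 :: 'k poly" and ?even = "poly (flow_poly \<Sigma>) 2 :: 'k poly"
  have count: "poly (poly (flow_poly \<Sigma>) (if odd n then 1 else 2)) (of_nat n :: 'k)
      = of_nat (card (nz_flows \<Sigma> (integer_mod_group n)))" if "n \<ge> 2" for n
    using that by (intro poly_flow_poly[OF assms(1)]) simp
  show odd: "counts_odd_nz_flows \<Sigma> ?odd"
    unfolding counts_odd_nz_flows_def
  proof (intro allI impI)
    fix n :: nat assume "2 \<le> n" "odd n"
    then show "poly ?odd (of_nat n) = of_nat (card (nz_flows \<Sigma> (integer_mod_group n)))"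
      using count[of n] by simp
  qed
  show even: "counts_even_nz_flows \<Sigma> ?even"
    unfolding counts_even_nz_flows_def
  proof (intro allI impI)
    fix n :: nat assume "2 \<le> n" "even n"
    then show "poly ?even (of_nat n) = of_nat (card (nz_flows \<Sigma> (integer_mod_group n)))"
      using count[of n] by simp
  qed
  have infinite: "infinite {n::nat. n \<ge> 2 \<and> odd n}" "infinite {n::nat. n \<ge> 2 \<and> even n}"
  proof -
    show "infinite {n::nat. n \<ge> 2 \<and> odd n}"
      by (rule infinite_super[of "range (\<lambda>m. 2 * m + 3)"]) (auto simp: finite_image_iff inj_on_def)
    show "infinite {n::nat. n \<ge> 2 \<and> even n}"
      by (rule infinite_super[of "range (\<lambda>m. 2 * m + 2)"]) (auto simp: finite_image_iff inj_on_def)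
  qed
  show "\<forall>p. counts_odd_nz_flows \<Sigma> p \<longrightarrow> p = ?odd"
    using odd by (intro allI impI poly_eq_if_eq_on_infinitely_many_nats[OF infinite(1)])
      (simp add: counts_odd_nz_flows_def)
  show "\<forall>p. counts_even_nz_flows \<Sigma> p \<longrightarrow> p = ?even"
    using even by (intro allI impI poly_eq_if_eq_on_infinitely_many_nats[OF infinite(2)])
      (simp add: counts_even_nz_flows_def)
qed simp_all

end
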